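(* Let $k,s\geq 2$ be integers. Then there exists a constant $C_{s,k}$ such that for every positive integer $n$, $$\mathrm{ex}^*(n,C_{2k},s)\leq C_{s,k}\, n^{1+1/k}.$$
   Context: $C_{2k}$ denotes the cycle of length $2k$. For a graph $H$ and integers $n,s\geq 1$, $\mathrm{ex}^*(n,H,s)$ denotes the maximum number of edges in an $n$-vertex graph which contains no copy of $K_{s,s}$ as a (not necessarily induced) subgraph and contains no induced copy of $H$. *)

theory Defs
  imports Complex_Main
begin

definition simple_graph :: "'a set \<Rightarrow> 'a set set \<Rightarrow> bool" where
  "simple_graph V E \<longleftrightarrow> finite V \<and>
     (\<forall>e\<in>E. \<exists>u v. u \<in> V \<and> v \<in> V \<and> u \<noteq> v \<and> e = {u, v})"

definition contains_Kss :: "'a set \<Rightarrow> 'a set set \<Rightarrow> nat \<Rightarrow> bool" where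
  "contains_Kss V E s \<longleftrightarrow> (\<exists>A B. A \<subseteq> V \<and> B \<subseteq> V \<and> A \<inter> B = {} \<and>
     card A = s \<and> card B = s \<and> (\<forall>a\<in>A. \<forall>b\<in>B. {a, b} \<in> E))"

definition contains_induced :: "'b set \<Rightarrow> 'b set set \<Rightarrow> 'a set \<Rightarrow> 'a set set \<Rightarrow> bool" where
  "contains_induced VH EH V E \<longleftrightarrow> (\<exists>f. inj_on f VH \<and> f ` VH \<subseteq> V \<and>
     (\<forall>u\<in>VH. \<forall>v\<in>VH. u \<noteq> v \<longrightarrow> ({u, v} \<in> EH \<longleftrightarrow> {f u, f v} \<in> E)))"

definition cycle_V :: "nat \<Rightarrow> nat set" where
  "cycle_V m = {0..<m}"

definition cycle_E :: "nat \<Rightarrow> nat set set" where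
  "cycle_E m = {{i, Suc i mod m} | i. i < m}"

definition ex_star :: "nat \<Rightarrow> 'b set \<Rightarrow> 'b set set \<Rightarrow> nat \<Rightarrow> nat" where
  "ex_star n VH EH s = Max {card E | E. simple_graph {0..<n} E \<and>
     \<not> contains_Kss {0..<n} E s \<and> \<not> contains_induced VH EH {0..<n} E}"

end

theory Submission
  imports Defs "HOL-Library.FuncSet" "HOL-Analysis.Convex"
begin

text \<open>
  Suppose the degrees are within a constant factor of d, where d is a large multiple of n^(1/k), and
  count closed walks of length 2k. Log-convexity of the even moments of the adjacency matrix shows
  that walks visiting the same vertex at two given symmetric positions of their two halves form a
  small fraction. Hence, for most pairs (x, y), weighted by the square of the number of k-walks
  from x to y, no vertex occupies a given interior position in a large fraction of these k-walks.
  For such pairs, a Kovari-Sos-Turan argument for measures with small atoms shows that two random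
  k-walks from x to y rarely have equal or adjacent vertices at two given interior positions. By
  rotation this rules out all coincidences and chords at once in some closed walk, which is then an
  induced cycle. A density-maximal vertex subset reduces the general case to almost regular graphs.
\<close>

subsection \<open>A Kovari-Sos-Turan theorem for functions with small fibres\<close>

text \<open>Forbidding K_{s,s} limits adjacency only between distributions spread over many
  vertices: where one vertex carries a positive fraction of the walks, it gives no information. The
  central quantity is therefore the share of closed 2k-walks whose two halves, both read as walks
  from x to y, agree at a given interior step. The moment of order 0 is n and the moment of order 2k
  is at least of order d^(2k), so log-convexity makes the last ratio of consecutive even moments at
  least of order d^2 / n^(1/k). Forcing an agreement costs one such ratio and gives back at most one
  maximum degree, so the share is O(n^(1/k) / d). This is where the exponent 1 + 1/k comes from, and
  why maximum and minimum degree must be comparable. Once x and y are fixed, the two halves are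
  independent uniform k-walks, which is the product structure that double counting needs. Any two
  positions at cyclic distance at least 2 can be rotated into the interiors of opposite halves, so
  one estimate serves every pair, and a union bound over at most 4k^2 pairs suffices.\<close>

lemma card_le_fibres:
  fixes c :: real
  assumes "finite S" and "\<And>v. real (card {p\<in>S. f p = v}) \<le> c"
  shows "real (card S) \<le> real (card (f ` S)) * c"
proof -
  have "real (card S) = (\<Sum>v\<in>f ` S. real (card {p\<in>S. f p = v}))"
    using card_eq_sum sum.image_gen[OF assms(1), of "\<lambda>_. 1::real" f] by simp
  also have "\<dots> \<le> (\<Sum>v\<in>f ` S. c)"
    by (intro sum_mono assms)
  finally show ?thesis by simp
qed

text \<open>Reverse Markov inequality: a bounded function with a large total must take large values
  often.\<close>

lemma sum_card_le_threshold:
  fixes h :: "'a \<Rightarrow> real"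
  assumes "finite S" and "\<And>p. p \<in> S \<Longrightarrow> h p \<le> M" and "M \<ge> 0" and "t \<ge> 0"
  shows "sum h S \<le> real (card {p\<in>S. h p \<ge> t}) * M + real (card S) * t"
proof -
  have "sum h S \<le> (\<Sum>p\<in>S. (if h p \<ge> t then M else 0) + t)"
    by (intro sum_mono) (use assms in \<open>auto intro: add_increasing2\<close>)
  also have "\<dots> = real (card {p\<in>S. h p \<ge> t}) * M + real (card S) * t"
    using assms(1) by (simp add: sum.distrib sum.If_cases Int_def)
  finally show ?thesis .
qed

lemma real_card_Sigma_pairs:
  assumes "finite P" "finite Q"
  shows "real (card {(p, q) \<in> P \<times> Q. S p q}) = (\<Sum>q\<in>Q. real (card {p\<in>P. S p q}))"
proof -
  have "{(p, q) \<in> P \<times> Q. S p q} = prod.swap ` Sigma Q (\<lambda>q. {p\<in>P. S p q})"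
    by (auto simp: image_iff)
  then have "card {(p, q) \<in> P \<times> Q. S p q} = card (Sigma Q (\<lambda>q. {p\<in>P. S p q}))"
    by (simp add: card_image)
  then show ?thesis using assms by simp
qed

text \<open>The usual double count, with vertices sampled through \<open>f\<close> and
  \<open>g\<close>: small fibres turn a positive fraction of \<open>P\<close> or \<open>Q\<close>
  into many distinct vertices. The bound \<open>\<delta>\<close> is fixed before the sets and the
  relation, which later makes the constant independent of the graph. The sets \<open>A\<close> and
  \<open>B\<close> may overlap here; disjointness will come from the absence of loops.\<close>

lemma Kovari_Sos_Turan_fibres:
  fixes \<epsilon> :: real and s :: nat
  assumes "\<epsilon> > 0" and "s \<ge> 1"
  shows "\<exists>\<delta>>0. \<forall>(P::'a set) (Q::'b set) (f::'a\<Rightarrow>'v) (g::'b\<Rightarrow>'v) R.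
    finite P \<longrightarrow> finite Q \<longrightarrow>
    (\<forall>v. real (card {p\<in>P. f p = v}) \<le> \<delta> * real (card P)) \<longrightarrow>
    (\<forall>v. real (card {q\<in>Q. g q = v}) \<le> \<delta> * real (card Q)) \<longrightarrow>
    \<not> (\<exists>A B. A \<subseteq> f ` P \<and> B \<subseteq> g ` Q \<and> card A = s \<and> card B = s \<and> (\<forall>a\<in>A. \<forall>b\<in>B. R a b)) \<longrightarrow>
    real (card {(p, q) \<in> P \<times> Q. R (f p) (g q)}) \<le> \<epsilon> * real (card P) * real (card Q)"
proof -
  \<comment> \<open>If each of \<open>m\<close> vertices is related to an \<epsilon>/2 fraction of
    \<open>P\<close>, an average element of \<open>P\<close> is related to at least 2s of them,
    twice the threshold \<open>s\<close> that defines \<open>Z\<close>.\<close>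
  define m where "m = nat \<lceil>4 * real s / \<epsilon>\<rceil>"
  have m: "real m \<ge> 4 * real s / \<epsilon>" unfolding m_def by linarith
  have m_pos: "m \<ge> 1"
    using assms unfolding m_def by (simp add: Suc_le_eq)
  have m\<epsilon>: "real m * \<epsilon> \<ge> 4 * real s" using m assms by (simp add: field_simps)
  \<comment> \<open>The first bound forces \<open>m\<close> distinct values of \<open>g\<close> on
    an \<epsilon>/2 fraction of \<open>Q\<close>. The second forces \<open>s\<close> distinct values
    of \<open>f\<close> on an \<epsilon>/4 fraction of \<open>P\<close>, after a loss of 2^m in the
    pigeonhole over subsets.\<close>
  define \<delta> where "\<delta> = min (\<epsilon> / (2 * real m)) (\<epsilon> / (4 * 2 ^ m * real s))"
  have "\<delta> > 0" using assms m_pos by (simp add: \<delta>_def)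
  have \<delta>1: "real m * \<delta> \<le> \<epsilon> / 2"
  proof -
    have "real m * \<delta> \<le> real m * (\<epsilon> / (2 * real m))"
      by (intro mult_left_mono) (auto simp: \<delta>_def)
    then show ?thesis using m_pos by simp
  qed
  have \<delta>2: "2 ^ m * real s * \<delta> \<le> \<epsilon> / 4"
  proof -
    have "2 ^ m * real s * \<delta> \<le> 2 ^ m * real s * (\<epsilon> / (4 * 2 ^ m * real s))"
      by (intro mult_left_mono) (auto simp: \<delta>_def)
    then show ?thesis using assms by simp
  qed
  have "real (card {(p, q) \<in> P \<times> Q. R (f p) (g q)}) \<le> \<epsilon> * real (card P) * real (card Q)"
    if fP: "finite P" and fQ: "finite Q"
      and af: "\<And>v. real (card {p\<in>P. f p = v}) \<le> \<delta> * real (card P)"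
      and ag: "\<And>v. real (card {q\<in>Q. g q = v}) \<le> \<delta> * real (card Q)"
      and noK: "\<not> (\<exists>A B. A \<subseteq> f ` P \<and> B \<subseteq> g ` Q \<and> card A = s \<and> card B = s \<and> (\<forall>a\<in>A. \<forall>b\<in>B. R a b))"
    for P :: "'a set" and Q :: "'b set" and f :: "'a \<Rightarrow> 'v" and g :: "'b \<Rightarrow> 'v" and R
  proof (rule ccontr)
    define w where "w = real (card P)"
    define w' where "w' = real (card Q)"
    define dg where "dg v = real (card {p\<in>P. R (f p) v})" for v
    assume "\<not> ?thesis"
    then have big: "(\<Sum>q\<in>Q. dg (g q)) > \<epsilon> * w * w'"
      unfolding dg_def w_def w'_def real_card_Sigma_pairs[OF fP fQ, symmetric] by simp
    have w_pos: "w > 0"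
    proof (rule ccontr)
      assume "\<not> w > 0"
      then have "P = {}" using fP by (simp add: w_def)
      then show False using big by (simp add: dg_def w_def)
    qed
    have w'_pos: "w' > 0"
    proof (rule ccontr)
      assume "\<not> w' > 0"
      then have "Q = {}" using fQ by (simp add: w'_def)
      then show False using big by (simp add: w'_def)
    qed
    define X where "X = {q\<in>Q. dg (g q) \<ge> \<epsilon> / 2 * w}"
    have "(\<Sum>q\<in>Q. dg (g q)) \<le> real (card X) * w + w' * (\<epsilon> / 2 * w)"
      unfolding X_def w'_def using fP fQ assms w_pos
      by (intro sum_card_le_threshold) (auto simp: dg_def w_def intro!: card_mono)
    with big have "\<epsilon> / 2 * w' * w < real (card X) * w" by (simp add: algebra_simps)
    then have cX: "real (card X) > \<epsilon> / 2 * w'" using w_pos by simp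
    have fX: "finite X" using fQ by (simp add: X_def)
    have "real (card X) \<le> real (card (g ` X)) * (\<delta> * w')"
    proof (rule card_le_fibres[OF fX])
      fix v
      have "card {p\<in>X. g p = v} \<le> card {q\<in>Q. g q = v}"
        using fQ by (intro card_mono) (auto simp: X_def)
      then show "real (card {p\<in>X. g p = v}) \<le> \<delta> * w'"
        using ag[of v] by (simp add: w'_def)
    qed
    with cX have "\<epsilon> / 2 * w' < real (card (g ` X)) * \<delta> * w'" by simp
    then have "\<epsilon> / 2 < real (card (g ` X)) * \<delta>" using w'_pos by (simp add: mult_less_cancel_right)
    with \<delta>1 have "real m * \<delta> < real (card (g ` X)) * \<delta>" by simp
    then have "m \<le> card (g ` X)" using \<open>\<delta> > 0\<close> by (simp add: mult_less_cancel_right)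
    then obtain Y where Y: "Y \<subseteq> g ` X" "card Y = m" "finite Y"
      by (meson obtain_subset_with_card_n)
    define h where "h p = real (card {y\<in>Y. R (f p) y})" for p
    define Z where "Z = {p\<in>P. h p \<ge> real s}"
    have fZ: "finite Z" using fP by (simp add: Z_def)
    have "real m * (\<epsilon> / 2 * w) = (\<Sum>y\<in>Y. \<epsilon> / 2 * w)" using Y by simp
    also have "\<dots> \<le> (\<Sum>y\<in>Y. dg y)"
      by (intro sum_mono) (use Y in \<open>auto simp: X_def\<close>)
    also have "\<dots> = (\<Sum>p\<in>P. h p)"
      using sum.swap_restrict[OF Y(3) fP, of "\<lambda>_ _. 1::real" "\<lambda>y p. R (f p) y"]
      by (simp add: dg_def h_def)
    also have "\<dots> \<le> real (card Z) * real m + w * real s"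
      unfolding Z_def w_def using fP Y
      by (intro sum_card_le_threshold) (auto simp: h_def intro!: card_mono)
    finally have "real m * (\<epsilon> / 2) * w \<le> real (card Z) * real m + w * real s" by simp
    moreover have "w * real s \<le> w * (real m * \<epsilon> / 4)"
      using m\<epsilon> w_pos by (intro mult_left_mono) auto
    ultimately have "real m * (\<epsilon> / 4 * w) \<le> real m * real (card Z)" by (simp add: algebra_simps)
    then have cZ: "\<epsilon> / 4 * w \<le> real (card Z)" using m_pos by simp
    have "\<exists>B. B \<subseteq> {y\<in>Y. R (f p) y} \<and> card B = s" if "p \<in> Z" for p
    proof -
      have "s \<le> card {y\<in>Y. R (f p) y}" using that by (simp add: Z_def h_def)
      then show ?thesis by (meson obtain_subset_with_card_n)
    qed
    then obtain T where T: "\<And>p. p \<in> Z \<Longrightarrow> T p \<subseteq> {y\<in>Y. R (f p) y} \<and> card (T p) = s"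
      by metis
    \<comment> \<open>Pigeonhole over the 2^m subsets of \<open>Y\<close>: a single \<open>B\<close>
      is the chosen s-set for many elements of \<open>Z\<close>, and their images under
      \<open>f\<close> provide the other side of the K_{s,s}.\<close>
    have "\<exists>B\<in>Pow Y. 2 ^ m * real (card {p\<in>Z. T p = B}) \<ge> real (card Z)"
    proof (rule ccontr)
      assume "\<not> ?thesis"
      then have less: "2 ^ m * real (card {p\<in>Z. T p = B}) < real (card Z)" if "B \<in> Pow Y" for B
        using that by (meson not_le)
      have "real (card Z) = (\<Sum>B\<in>Pow Y. real (card {p\<in>Z. T p = B}))"
      proof -
        have "T ` Z \<subseteq> Pow Y" using T by blast
        then show ?thesis
          using sum.group[OF fZ, of "Pow Y" T "\<lambda>_. 1::real"] Y(3) by simp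
      qed
      then have "2 ^ m * real (card Z) = (\<Sum>B\<in>Pow Y. 2 ^ m * real (card {p\<in>Z. T p = B}))"
        by (simp add: sum_distrib_left)
      also have "\<dots> < (\<Sum>B\<in>Pow Y. real (card Z))"
        using less Y(3) by (intro sum_strict_mono) auto
      also have "\<dots> = 2 ^ m * real (card Z)" using Y by (simp add: card_Pow)
      finally show False by simp
    qed
    then obtain B where B: "B \<subseteq> Y" "2 ^ m * real (card {p\<in>Z. T p = B}) \<ge> real (card Z)" by blast
    define ZB where "ZB = {p\<in>Z. T p = B}"
    have fZB: "finite ZB" using fZ by (simp add: ZB_def)
    have "real (card ZB) \<le> real (card (f ` ZB)) * (\<delta> * w)"
    proof (rule card_le_fibres[OF fZB])
      fix v
      have "card {p\<in>ZB. f p = v} \<le> card {p\<in>P. f p = v}"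
        using fP by (intro card_mono) (auto simp: ZB_def Z_def)
      then show "real (card {p\<in>ZB. f p = v}) \<le> \<delta> * w"
        using af[of v] by (simp add: w_def)
    qed
    then have "2 ^ m * real (card ZB) \<le> 2 ^ m * (real (card (f ` ZB)) * (\<delta> * w))"
      by (intro mult_left_mono) auto
    then have "2 ^ m * real (card ZB) \<le> 2 ^ m * real (card (f ` ZB)) * \<delta> * w"
      by (simp only: mult.assoc)
    then have "\<epsilon> / 4 * w \<le> 2 ^ m * real (card (f ` ZB)) * \<delta> * w"
      using cZ B(2) unfolding ZB_def by linarith
    then have "\<epsilon> / 4 \<le> 2 ^ m * real (card (f ` ZB)) * \<delta>" using w_pos by simp
    with \<delta>2 have "real s * (2 ^ m * \<delta>) \<le> real (card (f ` ZB)) * (2 ^ m * \<delta>)"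
      by (simp add: algebra_simps)
    then have "s \<le> card (f ` ZB)" using \<open>\<delta> > 0\<close> by simp
    then obtain A where A: "A \<subseteq> f ` ZB" "card A = s" by (meson obtain_subset_with_card_n)
    \<comment> \<open>The size of \<open>B\<close> is known only through some \<open>p\<close> with
      \<open>T p = B\<close>, so \<open>ZB\<close> has to be inhabited.\<close>
    then obtain a where "a \<in> A" using assms(2) by fastforce
    then have "ZB \<noteq> {}" using A by auto
    then have "card B = s" using T by (auto simp: ZB_def)
    moreover have "B \<subseteq> g ` Q" using B(1) Y(1) by (auto simp: X_def)
    moreover have "A \<subseteq> f ` P" using A by (auto simp: ZB_def Z_def)
    moreover have "\<forall>a\<in>A. \<forall>b\<in>B. R a b" using A T by (fastforce simp: ZB_def)
    ultimately show False using noK A by blast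
  qed
  then show ?thesis using \<open>\<delta> > 0\<close> by (intro exI[of _ \<delta>]) blast
qed

subsection \<open>Walks and moments\<close>

text \<open>The list omits the starting vertex, so its length is the number of edges and
  concatenating lists concatenates walks. Entry \<open>i\<close> is the vertex after
  \<open>i + 1\<close> steps, and the last entry of a nonempty list is the endpoint.\<close>

primrec walk :: "('a \<Rightarrow> 'a \<Rightarrow> bool) \<Rightarrow> 'a \<Rightarrow> 'a list \<Rightarrow> 'a \<Rightarrow> bool" where
  "walk adj x [] y \<longleftrightarrow> x = y"
| "walk adj x (z # zs) y \<longleftrightarrow> adj x z \<and> walk adj z zs y"

lemma walk_append: "walk adj x (xs @ ys) y \<longleftrightarrow> (\<exists>z. walk adj x xs z \<and> walk adj z ys y)"
  by (induction xs arbitrary: x) auto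

lemma walk_last: "walk adj x xs y \<Longrightarrow> last (x # xs) = y"
  by (induction xs arbitrary: x) auto

lemma walk_iff_nth:
  "walk adj x xs y \<longleftrightarrow> last (x # xs) = y \<and> (\<forall>i<length xs. adj ((x # xs) ! i) (xs ! i))"
  by (induction xs arbitrary: x) (auto simp: less_Suc_eq_0_disj All_less_Suc2)

locale fin_graph =
  fixes U :: "'a set" and adj :: "'a \<Rightarrow> 'a \<Rightarrow> bool"
  assumes finite_U: "finite U"
    and adj_sym: "adj x y \<Longrightarrow> adj y x"
    and adj_U: "adj x y \<Longrightarrow> x \<in> U"
begin

lemma adj_U2: "adj x y \<Longrightarrow> y \<in> U"
  using adj_sym adj_U by blast

definition walks :: "nat \<Rightarrow> 'a \<Rightarrow> 'a \<Rightarrow> 'a list set" where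
  "walks l x y = {xs. length xs = l \<and> walk adj x xs y}"

text \<open>The entry at (x, y) of the l-th power of the adjacency matrix; \<open>N_add\<close> is
  matrix multiplication.\<close>

definition N :: "nat \<Rightarrow> 'a \<Rightarrow> 'a \<Rightarrow> real" where
  "N l x y = real (card (walks l x y))"

lemma N_nonneg: "N l x y \<ge> 0"
  by (simp add: N_def)

lemma walk_in_U: "walk adj x xs y \<Longrightarrow> set xs \<subseteq> U"
  by (induction xs arbitrary: x) (auto dest: adj_U2)

lemma walk_end_in_U: "walk adj x xs y \<Longrightarrow> x \<in> U \<Longrightarrow> y \<in> U"
  by (induction xs arbitrary: x) (auto dest: adj_U2)

lemma finite_walks: "finite (walks l x y)"
proof (rule finite_subset)
  show "walks l x y \<subseteq> {xs. set xs \<subseteq> U \<and> length xs = l}"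
    using walk_in_U by (auto simp: walks_def)
  show "finite {xs. set xs \<subseteq> U \<and> length xs = l}"
    using finite_U by (rule finite_lists_length_eq)
qed

text \<open>The cut vertex is determined by the first piece, so the pieces over different
  \<open>z\<close> are disjoint. The free predicate \<open>S\<close> lets one cut serve plain
  counts, walks through a fixed vertex and pairs of halves.\<close>

lemma card_walks_split:
  assumes "x \<in> U"
  shows "real (card {xs \<in> walks (a + b) x y. S (take a xs) (drop a xs)}) =
    (\<Sum>z\<in>U. real (card {(ps, qs) \<in> walks a x z \<times> walks b z y. S ps qs}))"
proof -
  define D where "D z = {(ps, qs) \<in> walks a x z \<times> walks b z y. S ps qs}" for z
  have fD: "finite (D z)" for z
    unfolding D_def by (rule finite_subset[of _ "walks a x z \<times> walks b z y"]) (auto simp: finite_walks)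
  have disj: "D z \<inter> D z' = {}" if "z \<noteq> z'" for z z'
    using that unfolding D_def walks_def by (fastforce dest: walk_last)
  have "bij_betw (\<lambda>(ps, qs). ps @ qs) (\<Union>z\<in>U. D z) {xs \<in> walks (a + b) x y. S (take a xs) (drop a xs)}"
  proof (rule bij_betwI[where g = "\<lambda>xs. (take a xs, drop a xs)"])
    show "(\<lambda>(ps, qs). ps @ qs) \<in> (\<Union>z\<in>U. D z) \<rightarrow> {xs \<in> walks (a + b) x y. S (take a xs) (drop a xs)}"
      by (fastforce simp: D_def walks_def walk_append)
    show "(\<lambda>xs. (take a xs, drop a xs)) \<in> {xs \<in> walks (a + b) x y. S (take a xs) (drop a xs)} \<rightarrow> (\<Union>z\<in>U. D z)"
    proof
      fix xs assume xs: "xs \<in> {xs \<in> walks (a + b) x y. S (take a xs) (drop a xs)}"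
      then have "walk adj x (take a xs @ drop a xs) y" by (simp add: walks_def)
      then obtain z where z: "walk adj x (take a xs) z" "walk adj z (drop a xs) y"
        unfolding walk_append by blast
      then have "z \<in> U" using walk_end_in_U assms by blast
      with z xs show "(take a xs, drop a xs) \<in> (\<Union>z\<in>U. D z)"
        by (auto simp: D_def walks_def)
    qed
  next
    fix p assume "p \<in> (\<Union>z\<in>U. D z)"
    then have "length (fst p) = a" by (auto simp: D_def walks_def)
    then show "(\<lambda>xs. (take a xs, drop a xs)) ((\<lambda>(ps, qs). ps @ qs) p) = p"
      by (simp add: case_prod_unfold)
  qed simp
  then have "card {xs \<in> walks (a + b) x y. S (take a xs) (drop a xs)} = card (\<Union>z\<in>U. D z)"
    by (rule bij_betw_same_card[symmetric])
  also have "\<dots> = (\<Sum>z\<in>U. card (D z))"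
    using finite_U fD disj by (intro card_UN_disjoint) auto
  finally show ?thesis by (simp add: D_def)
qed

lemma N_add:
  assumes "x \<in> U"
  shows "N (a + b) x y = (\<Sum>z\<in>U. N a x z * N b z y)"
  using card_walks_split[OF assms, of a b y "\<lambda>_ _. True"]
  by (simp add: N_def card_cartesian_product flip: Sigma_def)

lemma N_0: "N 0 x y = (if x = y then 1 else 0)"
proof -
  have "walks 0 x y = (if x = y then {[]} else {})" by (auto simp: walks_def)
  then show ?thesis by (simp add: N_def)
qed

lemma N_1: "N 1 x y = (if adj x y then 1 else 0)"
proof -
  have "walks 1 x y = (if adj x y then {[y]} else {})" by (auto simp: walks_def length_Suc_conv)
  then show ?thesis by (simp add: N_def)
qed

lemma N_1_sym: "N 1 x y = N 1 y x"
  unfolding N_1 using adj_sym by auto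

lemma N_sym:
  assumes "x \<in> U" "y \<in> U"
  shows "N l x y = N l y x"
  using assms
proof (induction l arbitrary: x y)
  case 0
  then show ?case by (simp add: N_0)
next
  case (Suc l)
  have "N (Suc l) x y = (\<Sum>z\<in>U. N l x z * N 1 z y)"
    using N_add[OF Suc.prems(1), of l 1 y] by simp
  also have "\<dots> = (\<Sum>z\<in>U. N 1 y z * N l z x)"
    by (intro sum.cong refl) (simp add: Suc.IH Suc.prems N_1_sym[of y] del: One_nat_def)
  also have "\<dots> = N (Suc l) y x"
    using N_add[OF Suc.prems(2), of 1 l x] by simp
  finally show ?case .
qed

definition deg :: "'a \<Rightarrow> nat" where
  "deg x = card {y. adj x y}"

lemma sum_N_1: "(\<Sum>y\<in>U. N 1 x y) = real (deg x)"
proof -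
  have "{y. adj x y} = {y\<in>U. adj x y}" by (auto dest: adj_U2)
  then show ?thesis
    using finite_U by (simp add: N_1 deg_def sum.If_cases Int_def del: One_nat_def)
qed

text \<open>A diagonal entry of an even matrix power, that is, the squared norm of a row of the j-th
  power (\<open>b_sq\<close>).\<close>

definition b :: "nat \<Rightarrow> 'a \<Rightarrow> real" where
  "b j x = N (2 * j) x x"

lemma b_eq: "x \<in> U \<Longrightarrow> b (Suc 0) x = real (deg x)"
proof -
  assume x: "x \<in> U"
  have "b 1 x = (\<Sum>y\<in>U. N 1 x y * N 1 y x)"
    unfolding b_def using N_add[OF x, of 1 1 x] by (simp add: numeral_2_eq_2)
  also have "\<dots> = (\<Sum>y\<in>U. N 1 x y)"
    by (intro sum.cong refl) (auto simp: N_1 dest: adj_sym simp del: One_nat_def)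
  also have "\<dots> = real (deg x)" by (rule sum_N_1)
  finally show ?thesis by simp
qed

lemma N_prod_eq: "x \<in> U \<Longrightarrow> N (i + j) x x = (\<Sum>y\<in>U. N i x y * N j x y)"
  by (subst N_add) (auto intro!: sum.cong simp: N_sym)

lemma b_sq: "x \<in> U \<Longrightarrow> b j x = (\<Sum>y\<in>U. (N j x y)\<^sup>2)"
  by (simp add: b_def mult_2 N_prod_eq power2_eq_square)

text \<open>Splitting 2(j + 1) steps as j and j + 2 gives an inner product of the rows at x of the
  corresponding powers; Cauchy-Schwarz does the rest.\<close>

lemma b_log_convex:
  assumes "x \<in> U"
  shows "(b (Suc j) x)\<^sup>2 \<le> b j x * b (Suc (Suc j)) x"
proof -
  have "b (Suc j) x = (\<Sum>y\<in>U. N j x y * N (Suc (Suc j)) x y)"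
    unfolding b_def using N_prod_eq[OF assms, of j "Suc (Suc j)"] by (simp add: mult_2)
  then show ?thesis
    using assms by (simp add: b_sq Cauchy_Schwarz_ineq_sum)
qed

lemma b_nonneg: "b j x \<ge> 0"
  by (simp add: b_def N_nonneg)

text \<open>The trace of the 2j-th power of the adjacency matrix, hence the 2j-th moment of its
  spectrum.\<close>

definition T :: "nat \<Rightarrow> real" where
  "T j = (\<Sum>x\<in>U. b j x)"

lemma T_0: "T 0 = real (card U)"
  by (simp add: T_def b_def N_0)

lemma T_eq: "T j = (\<Sum>(x, y)\<in>U \<times> U. (N j x y)\<^sup>2)"
  by (simp add: T_def b_sq sum.cartesian_product)

text \<open>The same uneven split, now for whole matrices with the entrywise inner product.\<close>

lemma T_log_convex: "(T (Suc j))\<^sup>2 \<le> T j * T (Suc (Suc j))"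
proof -
  have "T (Suc j) = (\<Sum>(x, y)\<in>U \<times> U. N j x y * N (Suc (Suc j)) x y)"
    unfolding T_def sum.cartesian_product[symmetric]
  proof (intro sum.cong refl)
    fix x assume "x \<in> U"
    then show "b (Suc j) x = (\<Sum>y\<in>U. N j x y * N (Suc (Suc j)) x y)"
      unfolding b_def using N_prod_eq[of x j "Suc (Suc j)"] by (simp add: mult_2)
  qed
  then show ?thesis
    using Cauchy_Schwarz_ineq_sum[of "\<lambda>(x, y). N j x y" "\<lambda>(x, y). N (Suc (Suc j)) x y" "U \<times> U"]
    by (simp add: T_eq case_prod_unfold)
qed

end

section \<open>Log-convex sequences of positive reals\<close>

lemma log_convex_ratio_mono:
  fixes f :: "nat \<Rightarrow> real"
  assumes pos: "\<And>j. f j > 0" and lc: "\<And>j. (f (Suc j))\<^sup>2 \<le> f j * f (Suc (Suc j))" and "i \<le> j"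
  shows "f (Suc i) / f i \<le> f (Suc j) / f j"
proof (rule lift_Suc_mono_le[OF _ assms(3)])
  fix n
  show "f (Suc n) / f n \<le> f (Suc (Suc n)) / f (Suc n)"
    using lc[of n] pos by (simp add: divide_simps power2_eq_square mult.commute)
qed

text \<open>Moving one unit from the smaller index to the larger one keeps their sum and does not
  decrease the product; this is repeated until the smaller index is 1.\<close>

lemma log_convex_mult_le:
  fixes f :: "nat \<Rightarrow> real"
  assumes pos: "\<And>j. f j > 0" and lc: "\<And>j. (f (Suc j))\<^sup>2 \<le> f j * f (Suc (Suc j))"
  shows "p \<le> q \<Longrightarrow> f (Suc p) * f (Suc q) \<le> f (Suc 0) * f (Suc (p + q))"
proof (induction p arbitrary: q)
  case (Suc p)
  have "f (Suc (Suc p)) / f (Suc p) \<le> f (Suc (Suc q)) / f (Suc q)"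
    by (rule log_convex_ratio_mono[of f, OF pos lc]) (use Suc.prems in simp)
  then have "f (Suc (Suc p)) * f (Suc q) \<le> f (Suc p) * f (Suc (Suc q))"
    using pos[of "Suc p"] pos[of "Suc q"] by (simp add: divide_simps mult.commute)
  also have "\<dots> \<le> f (Suc 0) * f (Suc (p + Suc q))"
    using Suc.prems by (intro Suc.IH) simp
  finally show ?case by simp
qed simp

text \<open>The left side telescopes into \<open>k\<close> ratios of neighbours, none larger than
  the ratio at \<open>m\<close>. With \<open>m = k - 1\<close> this bounds the last ratio from
  below.\<close>

lemma log_convex_growth:
  fixes f :: "nat \<Rightarrow> real"
  assumes pos: "\<And>j. f j > 0" and lc: "\<And>j. (f (Suc j))\<^sup>2 \<le> f j * f (Suc (Suc j))"
  shows "k \<le> Suc m \<Longrightarrow> f k / f 0 \<le> (f (Suc m) / f m) ^ k"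
proof (induction k)
  case 0
  then show ?case using pos[of 0] by simp
next
  case (Suc k)
  have "f (Suc k) / f 0 = (f k / f 0) * (f (Suc k) / f k)" using pos[of k] by simp
  also have "\<dots> \<le> (f (Suc m) / f m) ^ k * (f (Suc m) / f m)"
    using Suc pos less_imp_le[OF pos]
    by (intro mult_mono log_convex_ratio_mono[of f, OF pos lc]) auto
  finally show ?case by (simp add: mult.commute)
qed

section \<open>Moments under two-sided degree bounds\<close>

context fin_graph
begin

lemma sum_N_ge:
  assumes deg: "\<And>x. x \<in> U \<Longrightarrow> \<theta> \<le> real (deg x)" and "\<theta> \<ge> 0" and "x \<in> U"
  shows "\<theta> ^ l \<le> (\<Sum>y\<in>U. N l x y)"
  using \<open>x \<in> U\<close>
proof (induction l arbitrary: x)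
  case 0
  then show ?case using finite_U by (simp add: N_0)
next
  case (Suc l)
  have "\<theta> ^ Suc l \<le> real (deg x) * \<theta> ^ l"
    using deg[OF Suc.prems] assms(2) by (simp add: mult_right_mono)
  also have "\<dots> = (\<Sum>z\<in>U. N 1 x z * \<theta> ^ l)"
    by (simp only: sum_N_1 flip: sum_distrib_right)
  also have "\<dots> \<le> (\<Sum>z\<in>U. N 1 x z * (\<Sum>y\<in>U. N l z y))"
    by (intro sum_mono mult_left_mono Suc.IH N_nonneg)
  also have "\<dots> = (\<Sum>y\<in>U. \<Sum>z\<in>U. N 1 x z * N l z y)"
    unfolding sum_distrib_left by (rule sum.swap)
  also have "\<dots> = (\<Sum>y\<in>U. N (Suc l) x y)"
    using N_add[OF Suc.prems, of 1 l] by simp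
  finally show ?case .
qed

text \<open>There are at least n \<theta>^k walks of length k, spread over n^2 pairs of endpoints,
  and T k is the sum of the squared counts; Cauchy-Schwarz cancels both factors n.\<close>

lemma T_ge:
  assumes deg: "\<And>x. x \<in> U \<Longrightarrow> \<theta> \<le> real (deg x)" and "\<theta> \<ge> 0" and "U \<noteq> {}"
  shows "\<theta> ^ (2 * k) \<le> T k"
proof -
  have n: "real (card U) > 0" using assms finite_U by (simp add: card_gt_0_iff)
  have "real (card U) * \<theta> ^ k = (\<Sum>x\<in>U. \<theta> ^ k)" by simp
  also have "\<dots> \<le> (\<Sum>x\<in>U. \<Sum>y\<in>U. N k x y)"
    by (intro sum_mono sum_N_ge[OF deg assms(2)])
  also have "\<dots> = (\<Sum>(x, y)\<in>U \<times> U. N k x y * 1)" by (simp add: sum.cartesian_product)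
  finally have "(real (card U) * \<theta> ^ k)\<^sup>2 \<le> (\<Sum>(x, y)\<in>U \<times> U. N k x y * 1)\<^sup>2"
    using assms(2) by (intro power_mono) auto
  also have "\<dots> \<le> (\<Sum>(x, y)\<in>U \<times> U. (N k x y)\<^sup>2) * (\<Sum>(x, y)\<in>U \<times> U. 1\<^sup>2)"
    using Cauchy_Schwarz_ineq_sum[of "\<lambda>(x, y). N k x y" "\<lambda>_. 1" "U \<times> U"]
    by (simp add: case_prod_unfold)
  also have "\<dots> = (real (card U))\<^sup>2 * T k"
    by (simp add: T_eq card_cartesian_product power2_eq_square)
  finally have "(real (card U))\<^sup>2 * \<theta> ^ (2 * k) \<le> (real (card U))\<^sup>2 * T k"
    by (simp add: power_mult_distrib power_even_eq)
  then show ?thesis using n by simp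
qed

text \<open>Two consecutive positive values are carried through the induction, since log-convexity
  then forces the next one to be nonzero.\<close>

lemma b_pos:
  assumes "x \<in> U" and "deg x > 0"
  shows "b j x > 0"
proof -
  have "b j x > 0 \<and> b (Suc j) x > 0"
  proof (induction j)
    case 0
    then show ?case using assms by (simp add: b_eq) (simp add: b_def N_0)
  next
    case (Suc j)
    then have "0 < (b (Suc j) x)\<^sup>2" by simp
    also have "\<dots> \<le> b j x * b (Suc (Suc j)) x" by (rule b_log_convex[OF assms(1)])
    finally show ?case using Suc by (simp add: zero_less_mult_iff)
  qed
  then show ?thesis ..
qed

text \<open>
  Log-convexity moves the product of moments to its extreme case j = 1, where the moment of order 2
  is a degree; T (k - 1) is compared with T k because the ratios of the moments T increase.
\<close>

lemma sum_b_mult_le: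
  assumes deg: "\<And>x. x \<in> U \<Longrightarrow> \<theta> \<le> real (deg x)" "\<And>x. x \<in> U \<Longrightarrow> real (deg x) \<le> \<Delta>"
    and "\<theta> > 0" and "U \<noteq> {}" and j: "1 \<le> j" "j < k" and \<nu>: "\<nu> \<ge> 0" "\<nu> ^ k = real (card U)"
  shows "\<theta>\<^sup>2 * (\<Sum>x\<in>U. b j x * b (k - j) x) \<le> \<Delta> * \<nu> * T k"
proof -
  have deg_pos: "deg x > 0" if "x \<in> U" for x
    using deg(1)[OF that] assms(3) by simp
  have b_le: "b j x * b (k - j) x \<le> \<Delta> * b (k - 1) x" if "x \<in> U" for x
  proof -
    note pos = b_pos[OF that deg_pos[OF that]] and lc = b_log_convex[OF that]
    obtain p q where pq: "j = Suc p" "k - j = Suc q"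
      using j by (metis Suc_diff_Suc diff_0_eq_0 not0_implies_Suc not_one_le_zero)
    then have k: "k - 1 = Suc (p + q)" "Suc (q + p) = Suc (p + q)" by simp_all
    have "b j x * b (k - j) x \<le> b (Suc 0) x * b (k - 1) x"
      using log_convex_mult_le[of "\<lambda>j. b j x", OF pos lc, of p q]
        log_convex_mult_le[of "\<lambda>j. b j x", OF pos lc, of q p]
      unfolding pq(2) k(1) unfolding pq(1) k(2) by (cases "p \<le> q") (simp_all only: mult.commute)
    also have "\<dots> \<le> \<Delta> * b (k - 1) x"
      using deg(2)[OF that] that by (intro mult_right_mono b_nonneg) (simp add: b_eq)
    finally show ?thesis .
  qed
  have T_pos: "T i > 0" for i
    unfolding T_def using finite_U assms(4) by (intro sum_pos b_pos deg_pos) auto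
  have "\<theta>\<^sup>2 \<le> \<nu> * (T k / T (k - 1))"
  \<comment> \<open>The k-th powers are compared: \<open>\<nu> ^ k\<close> is the number of
    vertices, that is \<open>T 0\<close>, and it turns \<open>T k\<close> into
    \<open>T k / T 0\<close>, which is at most the k-th power of the last ratio.\<close>
  proof (rule power_le_imp_le_base)
    have "(\<theta>\<^sup>2) ^ Suc (k - 1) \<le> T k"
      using T_ge[of \<theta> k] deg(1) assms(3,4) j by (simp flip: power_mult)
    also have "T k = \<nu> ^ k * (T k / T 0)"
      using T_pos[of 0] by (simp add: T_0 \<nu>)
    also have "\<dots> \<le> \<nu> ^ k * (T (Suc (k - 1)) / T (k - 1)) ^ k"
      using \<nu> j by (intro mult_left_mono log_convex_growth T_pos T_log_convex) auto
    also have "\<dots> = (\<nu> * (T k / T (k - 1))) ^ Suc (k - 1)"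
      unfolding power_mult_distrib using j by simp
    finally show "(\<theta>\<^sup>2) ^ Suc (k - 1) \<le> (\<nu> * (T k / T (k - 1))) ^ Suc (k - 1)" .
    show "0 \<le> \<nu> * (T k / T (k - 1))" using \<nu> less_imp_le[OF T_pos] by (intro mult_nonneg_nonneg divide_nonneg_nonneg)
  qed
  then have T: "\<theta>\<^sup>2 * T (k - 1) \<le> \<nu> * T k"
    using T_pos[of "k - 1"] by (simp add: divide_simps mult.commute)
  have "\<Delta> \<ge> 0" using deg assms(3,4) by fastforce
  have "(\<Sum>x\<in>U. b j x * b (k - j) x) \<le> \<Delta> * T (k - 1)"
    unfolding T_def sum_distrib_left by (intro sum_mono b_le)
  then have "\<theta>\<^sup>2 * (\<Sum>x\<in>U. b j x * b (k - j) x) \<le> \<theta>\<^sup>2 * (\<Delta> * T (k - 1))"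
    by (rule mult_left_mono) simp
  also have "\<dots> = \<Delta> * (\<theta>\<^sup>2 * T (k - 1))" by simp
  also have "\<dots> \<le> \<Delta> * (\<nu> * T k)"
    using T \<open>\<Delta> \<ge> 0\<close> by (rule mult_left_mono)
  finally show ?thesis by simp
qed

subsection \<open>Closed walks\<close>

text \<open>Cyclic indexing makes rotation a symmetry. Root and orientation are kept, so that the
  number of these lists is a trace.\<close>

definition closed_walks :: "nat \<Rightarrow> 'a list set" where
  "closed_walks m = {xs. length xs = m \<and> (\<forall>i<m. adj (xs ! i) (xs ! (Suc i mod m)))}"

lemma rotate_closed_walks:
  assumes "xs \<in> closed_walks m"
  shows "rotate r xs \<in> closed_walks m"
  unfolding closed_walks_def
proof (intro CollectI conjI allI impI)
  show "length (rotate r xs) = m" using assms by (simp add: closed_walks_def)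
  fix i assume i: "i < m"
  have "adj (xs ! ((r + i) mod m)) (xs ! (Suc ((r + i) mod m) mod m))"
    using assms i by (simp add: closed_walks_def)
  moreover have "Suc ((r + i) mod m) mod m = (r + Suc i mod m) mod m"
    by (simp add: mod_Suc_eq mod_add_right_eq)
  ultimately show "adj (rotate r xs ! i) (rotate r xs ! (Suc i mod m))"
    using assms i by (simp add: closed_walks_def nth_rotate)
qed

text \<open>Since a walk omits its start, the starting vertex of a cyclic list is its last
  entry.\<close>

lemma closed_walks_iff_walk:
  assumes "m > 0"
  shows "xs \<in> closed_walks m \<longleftrightarrow> length xs = m \<and> walk adj (last xs) xs (last xs)"
proof (cases "length xs = m")
  case True
  with assms have ne: "xs \<noteq> []" by auto
  then have last: "last xs = xs ! (m - 1)" using True by (simp add: last_conv_nth)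
  have "(\<forall>i<m. adj (xs ! i) (xs ! (Suc i mod m))) \<longleftrightarrow> (\<forall>i<m. adj ((last xs # xs) ! i) (xs ! i))"
  proof (intro iffI allI impI)
    fix i assume *: "\<forall>i<m. adj (xs ! i) (xs ! (Suc i mod m))" and i: "i < m"
    show "adj ((last xs # xs) ! i) (xs ! i)"
    proof (cases i)
      case 0
      then show ?thesis using *[rule_format, of "m - 1"] assms last by simp
    next
      case (Suc i')
      then show ?thesis using *[rule_format, of i'] i by simp
    qed
  next
    fix i assume *: "\<forall>i<m. adj ((last xs # xs) ! i) (xs ! i)" and i: "i < m"
    show "adj (xs ! i) (xs ! (Suc i mod m))"
    proof (cases "Suc i = m")
      case True
      then show ?thesis using *[rule_format, of 0] assms last by auto
    next
      case False
      then show ?thesis using *[rule_format, of "Suc i"] i by simp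
    qed
  qed
  then show ?thesis using True ne by (simp add: closed_walks_def walk_iff_nth)
qed (auto simp: closed_walks_def)

lemma card_closed_walks_split:
  assumes "k > 0"
  shows "real (card {xs \<in> closed_walks (2 * k). S (take k xs) (drop k xs)}) =
    (\<Sum>x\<in>U. \<Sum>y\<in>U. real (card {(ps, qs) \<in> walks k x y \<times> walks k y x. S ps qs}))"
proof -
  define D where "D x = {xs \<in> walks (k + k) x x. S (take k xs) (drop k xs)}" for x
  have "{xs \<in> closed_walks (2 * k). S (take k xs) (drop k xs)} = (\<Union>x\<in>U. D x)"
  proof (intro equalityI subsetI)
    fix xs assume "xs \<in> {xs \<in> closed_walks (2 * k). S (take k xs) (drop k xs)}"
    then have xs: "length xs = k + k" "walk adj (last xs) xs (last xs)" "S (take k xs) (drop k xs)"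
      using assms by (auto simp: closed_walks_iff_walk)
    then have "last xs \<in> set xs" using assms by (intro last_in_set) auto
    then have "last xs \<in> U" using walk_in_U xs(2) by blast
    with xs show "xs \<in> (\<Union>x\<in>U. D x)" by (auto simp: D_def walks_def)
  next
    fix xs assume "xs \<in> (\<Union>x\<in>U. D x)"
    then obtain x where x: "walk adj x xs x" "length xs = k + k" "S (take k xs) (drop k xs)"
      by (auto simp: D_def walks_def)
    then have "xs \<noteq> []" using assms by auto
    then have "last xs = x" using walk_last[OF x(1)] by simp
    with x show "xs \<in> {xs \<in> closed_walks (2 * k). S (take k xs) (drop k xs)}"
      using assms by (simp add: closed_walks_iff_walk)
  qed
  moreover have "card (\<Union>x\<in>U. D x) = (\<Sum>x\<in>U. card (D x))"
  proof (rule card_UN_disjoint[OF finite_U])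
    show "\<forall>x\<in>U. finite (D x)" by (simp add: D_def finite_walks)
    have "x = y" if "xs \<in> D x" "xs \<in> D y" for x y xs
    proof -
      have "xs \<noteq> []" "walk adj x xs x" "walk adj y xs y"
        using that assms by (auto simp: D_def walks_def)
      then show ?thesis using walk_last[of adj x xs x] walk_last[of adj y xs y] by simp
    qed
    then show "\<forall>x\<in>U. \<forall>y\<in>U. x \<noteq> y \<longrightarrow> D x \<inter> D y = {}" by blast
  qed
  ultimately have "real (card {xs \<in> closed_walks (2 * k). S (take k xs) (drop k xs)}) =
      (\<Sum>x\<in>U. real (card (D x)))"
    by simp
  also have "\<dots> = (\<Sum>x\<in>U. \<Sum>y\<in>U. real (card {(ps, qs) \<in> walks k x y \<times> walks k y x. S ps qs}))"
    unfolding D_def by (intro sum.cong refl card_walks_split)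
  finally show ?thesis .
qed

lemma card_closed_walks:
  assumes "k > 0"
  shows "real (card (closed_walks (2 * k))) = T k"
proof -
  have "real (card (closed_walks (2 * k))) = (\<Sum>x\<in>U. \<Sum>y\<in>U. N k x y * N k y x)"
    using card_closed_walks_split[OF assms, of "\<lambda>_ _. True"]
    by (simp add: N_def card_cartesian_product flip: Sigma_def)
  also have "\<dots> = T k"
    unfolding T_def b_def mult_2 by (intro sum.cong refl) (simp add: N_add)
  finally show ?thesis .
qed

lemma finite_closed_walks: "finite (closed_walks m)"
proof (cases "m = 0")
  case False
  then have "closed_walks m \<subseteq> {xs. set xs \<subseteq> U \<and> length xs = m}"
    by (auto simp: closed_walks_iff_walk dest: subsetD[OF walk_in_U])
  then show ?thesis using finite_U by (rule finite_subset[OF _ finite_lists_length_eq])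
qed (auto simp: closed_walks_def intro: finite_subset[of _ "{[]}"])

section \<open>Walks through a prescribed vertex and coincidences between the two halves\<close>

lemma card_walks_through:
  assumes "x \<in> U" and "v \<in> U" and "a < k"
  shows "real (card {ps \<in> walks k x y. ps ! a = v}) = N (Suc a) x v * N (k - Suc a) v y"
proof -
  have k: "Suc a + (k - Suc a) = k" using assms by simp
  have "real (card {ps \<in> walks (Suc a + (k - Suc a)) x y. take (Suc a) ps ! a = v}) =
      (\<Sum>z\<in>U. real (card {(ps, qs) \<in> walks (Suc a) x z \<times> walks (k - Suc a) z y. ps ! a = v}))"
    using assms(1) by (rule card_walks_split)
  also have "\<dots> = (\<Sum>z\<in>U. if z = v then N (Suc a) x v * N (k - Suc a) v y else 0)"
  proof (intro sum.cong refl)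
    fix z
    \<comment> \<open>Index \<open>a\<close> is the endpoint of the first \<open>Suc a\<close>
      steps, so only the cut at \<open>z = v\<close> contributes.\<close>
    have "ps ! a = z" if "ps \<in> walks (Suc a) x z" for ps
    proof -
      have "length ps = Suc a" "walk adj x ps z" using that by (auto simp: walks_def)
      then show ?thesis using walk_last[of adj x ps z]
        by (cases "ps = []") (auto simp: last_conv_nth)
    qed
    then have "{(ps, qs) \<in> walks (Suc a) x z \<times> walks (k - Suc a) z y. ps ! a = v} =
        (if z = v then walks (Suc a) x z \<times> walks (k - Suc a) z y else {})"
      by auto
    then show "real (card {(ps, qs) \<in> walks (Suc a) x z \<times> walks (k - Suc a) z y. ps ! a = v}) =
        (if z = v then N (Suc a) x v * N (k - Suc a) v y else 0)"
      by (simp add: N_def card_cartesian_product)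
  qed
  also have "\<dots> = N (Suc a) x v * N (k - Suc a) v y"
    using assms finite_U by simp
  finally show ?thesis by (simp only: k nth_take[OF lessI])
qed

text \<open>For fixed \<open>v\<close> the sum over x and y factors into two squared row norms. The
  result counts pairs of k-walks with common endpoints that both pass through the same vertex at
  step \<open>Suc a\<close>.\<close>

lemma sum_through_sq:
  assumes "a < k"
  shows "(\<Sum>x\<in>U. \<Sum>y\<in>U. \<Sum>v\<in>U. (N (Suc a) x v * N (k - Suc a) v y)\<^sup>2) =
    (\<Sum>v\<in>U. b (Suc a) v * b (k - Suc a) v)"
proof -
  have "(\<Sum>x\<in>U. \<Sum>y\<in>U. \<Sum>v\<in>U. (N (Suc a) x v * N (k - Suc a) v y)\<^sup>2) =
      (\<Sum>x\<in>U. \<Sum>v\<in>U. \<Sum>y\<in>U. (N (Suc a) x v)\<^sup>2 * (N (k - Suc a) v y)\<^sup>2)"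
    unfolding power_mult_distrib by (intro sum.cong refl sum.swap)
  also have "\<dots> = (\<Sum>v\<in>U. \<Sum>x\<in>U. \<Sum>y\<in>U. (N (Suc a) v x)\<^sup>2 * (N (k - Suc a) v y)\<^sup>2)"
    by (subst sum.swap, intro sum.cong refl) (simp add: N_sym)
  also have "\<dots> = (\<Sum>v\<in>U. b (Suc a) v * b (k - Suc a) v)"
    by (intro sum.cong refl) (simp add: b_sq sum_product)
  finally show ?thesis .
qed

text \<open>
  The last two sums are the price for the pairs (x, y) for which some vertex occupies position a of
  the first or position c of the second walk with probability more than \<open>\<delta>\<close>.
\<close>

lemma card_walk_pairs_le:
  fixes \<epsilon> \<delta> :: real
  assumes KST: "\<And>(P::'a list set) (Q::'a list set) (f::'a list\<Rightarrow>'a) (g::'a list\<Rightarrow>'a).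
      finite P \<Longrightarrow> finite Q \<Longrightarrow> f ` P \<subseteq> U \<Longrightarrow> g ` Q \<subseteq> U \<Longrightarrow>
      (\<And>v. real (card {p\<in>P. f p = v}) \<le> \<delta> * real (card P)) \<Longrightarrow>
      (\<And>v. real (card {q\<in>Q. g q = v}) \<le> \<delta> * real (card Q)) \<Longrightarrow>
      real (card {(p, q) \<in> P \<times> Q. adj (f p) (g q)}) \<le> \<epsilon> * real (card P) * real (card Q)"
    and "\<delta> > 0" "\<delta> \<le> \<epsilon>" and ac: "a + 1 < k" "c + 1 < k" and xy: "x \<in> U" "y \<in> U"
  shows "real (card {(ps, qs) \<in> walks k x y \<times> walks k y x. ps ! a = qs ! c \<or> adj (ps ! a) (qs ! c)})
    \<le> 2 * \<epsilon> * (N k x y)\<^sup>2 + 1 / \<delta>\<^sup>2 * ((\<Sum>v\<in>U. (N (Suc a) x v * N (k - Suc a) v y)\<^sup>2) +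
        (\<Sum>v\<in>U. (N (k - Suc c) x v * N (Suc c) v y)\<^sup>2))"
proof -
  define w where "w = N k x y"
  define P where "P = walks k x y"
  define Q where "Q = walks k y x"
  define A where "A v = N (Suc a) x v * N (k - Suc a) v y" for v
  \<comment> \<open>The second walk runs from y to x. Reversing it exchanges the two step counts and
    brings \<open>B\<close> to the same shape as \<open>A\<close>.\<close>
  define B where "B v = N (k - Suc c) x v * N (Suc c) v y" for v
  define D where "D = {(ps, qs) \<in> P \<times> Q. ps ! a = qs ! c \<or> adj (ps ! a) (qs ! c)}"
  have fin: "finite P" "finite Q" by (simp_all add: P_def Q_def finite_walks)
  have cP: "real (card P) = w" and cQ: "real (card Q) = w"
    using N_sym[OF xy, of k] by (simp_all add: w_def P_def Q_def N_def)
  have w: "w \<ge> 0" by (simp add: w_def N_nonneg)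
  have in_U: "zs ! i \<in> U" if "zs \<in> walks k u v" "i < k" for zs u v i
    using that walk_in_U[of u zs v] by (auto simp: walks_def)
  have A: "real (card {ps \<in> P. ps ! a = v}) = A v" if "v \<in> U" for v
    unfolding P_def A_def using xy that ac by (intro card_walks_through) auto
  have B: "real (card {qs \<in> Q. qs ! c = v}) = B v" if "v \<in> U" for v
    unfolding Q_def B_def using xy that ac by (subst card_walks_through) (auto simp: N_sym)
  have sq_nonneg: "(\<Sum>v\<in>U. (A v)\<^sup>2) \<ge> 0" "(\<Sum>v\<in>U. (B v)\<^sup>2) \<ge> 0"
    by (simp_all add: sum_nonneg)
  have "real (card D) \<le> 2 * \<epsilon> * w\<^sup>2 + 1 / \<delta>\<^sup>2 * ((\<Sum>v\<in>U. (A v)\<^sup>2) + (\<Sum>v\<in>U. (B v)\<^sup>2))"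
  proof (cases "\<exists>v\<in>U. A v > \<delta> * w \<or> B v > \<delta> * w")
    case True
    then obtain v where v: "v \<in> U" "A v > \<delta> * w \<or> B v > \<delta> * w" by blast
    have "card D \<le> card (P \<times> Q)"
      by (rule card_mono) (use fin in \<open>auto simp: D_def\<close>)
    then have "real (card D) \<le> real (card (P \<times> Q))" by (rule of_nat_mono)
    then have "real (card D) \<le> w * w" unfolding card_cartesian_product of_nat_mult cP cQ .
    \<comment> \<open>One heavy vertex alone contributes at least (\<delta> w)^2 to one of the sums,
      so the trivial bound w^2 on \<open>D\<close> is affordable.\<close>
    moreover have "\<delta>\<^sup>2 * w\<^sup>2 \<le> (\<Sum>v\<in>U. (A v)\<^sup>2) + (\<Sum>v\<in>U. (B v)\<^sup>2)"
    proof -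
      have "(A v)\<^sup>2 \<le> (\<Sum>v\<in>U. (A v)\<^sup>2)" "(B v)\<^sup>2 \<le> (\<Sum>v\<in>U. (B v)\<^sup>2)"
        using member_le_sum[of v U "\<lambda>v. (A v)\<^sup>2"] member_le_sum[of v U "\<lambda>v. (B v)\<^sup>2"] finite_U v(1)
        by simp_all
      moreover have "(\<delta> * w)\<^sup>2 \<le> (A v)\<^sup>2 \<or> (\<delta> * w)\<^sup>2 \<le> (B v)\<^sup>2"
        using v(2) w assms(2) power_mono[of "\<delta> * w" "A v" 2] power_mono[of "\<delta> * w" "B v" 2] by fastforce
      ultimately show ?thesis using sq_nonneg by (auto simp: power_mult_distrib)
    qed
    then have "w\<^sup>2 \<le> 1 / \<delta>\<^sup>2 * ((\<Sum>v\<in>U. (A v)\<^sup>2) + (\<Sum>v\<in>U. (B v)\<^sup>2))"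
      using assms(2) by (simp add: field_simps)
    moreover have "0 \<le> 2 * \<epsilon> * w\<^sup>2" using assms by simp
    ultimately show ?thesis by (simp add: power2_eq_square)
  next
    case False
    have "real (card {ps\<in>P. ps ! a = v}) \<le> \<delta> * w" for v
    proof (cases "v \<in> U")
      case True
      with False A show ?thesis by (metis not_le)
    next
      case False
      then have none: "{ps\<in>P. ps ! a = v} = {}" unfolding P_def using in_U[of _ x y a] ac by auto
      show ?thesis using w assms(2) unfolding none by simp
    qed
    note atomP = this
    have "real (card {qs\<in>Q. qs ! c = v}) \<le> \<delta> * w" for v
    proof (cases "v \<in> U")
      case True
      with False B show ?thesis by (metis not_le)
    next
      case False
      then have none: "{qs\<in>Q. qs ! c = v} = {}" unfolding Q_def using in_U[of _ y x c] ac by auto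
      show ?thesis using w assms(2) unfolding none by simp
    qed
    note atomQ = this
    \<comment> \<open>For fixed \<open>qs\<close>, the walks \<open>ps\<close> that meet it here
      form a single fibre, so small fibres bound coincidences directly; \<delta> \<le> \<epsilon>
      lets equality and adjacency share one error term.\<close>
    have "real (card {(ps, qs) \<in> P \<times> Q. ps ! a = qs ! c}) = (\<Sum>qs\<in>Q. real (card {ps\<in>P. ps ! a = qs ! c}))"
      by (rule real_card_Sigma_pairs[OF fin])
    also have "\<dots> \<le> (\<Sum>qs\<in>Q. \<delta> * w)" by (intro sum_mono atomP)
    also have "\<dots> = \<delta> * w\<^sup>2" by (simp add: cQ power2_eq_square)
    also have "\<dots> \<le> \<epsilon> * w\<^sup>2" using assms(3) by (intro mult_right_mono) auto
    finally have 1: "real (card {(ps, qs) \<in> P \<times> Q. ps ! a = qs ! c}) \<le> \<epsilon> * w\<^sup>2" .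
    have "real (card {(ps, qs) \<in> P \<times> Q. adj (ps ! a) (qs ! c)}) \<le> \<epsilon> * real (card P) * real (card Q)"
    proof (rule KST[OF fin, where f = "\<lambda>p. p ! a" and g = "\<lambda>q. q ! c"])
      show "(\<lambda>p. p ! a) ` P \<subseteq> U" unfolding P_def using in_U ac by auto
      show "(\<lambda>q. q ! c) ` Q \<subseteq> U" unfolding Q_def using in_U ac by auto
    qed (simp_all only: atomP atomQ cP cQ)
    then have 2: "real (card {(ps, qs) \<in> P \<times> Q. adj (ps ! a) (qs ! c)}) \<le> \<epsilon> * w\<^sup>2"
      by (simp add: cP cQ power2_eq_square)
    have "D = {(ps, qs) \<in> P \<times> Q. ps ! a = qs ! c} \<union> {(ps, qs) \<in> P \<times> Q. adj (ps ! a) (qs ! c)}"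
      by (auto simp: D_def)
    then have "card D \<le> card {(ps, qs) \<in> P \<times> Q. ps ! a = qs ! c} +
        card {(ps, qs) \<in> P \<times> Q. adj (ps ! a) (qs ! c)}"
      by (simp only: card_Un_le)
    with 1 2 have "real (card D) \<le> 2 * \<epsilon> * w\<^sup>2" by linarith
    moreover have "0 \<le> 1 / \<delta>\<^sup>2 * ((\<Sum>v\<in>U. (A v)\<^sup>2) + (\<Sum>v\<in>U. (B v)\<^sup>2))"
      using sq_nonneg by simp
    ultimately show ?thesis by linarith
  qed
  then show ?thesis by (simp add: D_def P_def Q_def A_def B_def w_def)
qed

text \<open>The conditions on i and j say that their cyclic distance in a 2k-cycle is at least 2,
  which is exactly what allows both to avoid the common endpoints of the halves after
  rotation.\<close>

lemma card_bad_closed_walks_le: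
  fixes \<epsilon> \<delta> \<eta> :: real
  assumes KST: "\<And>(P::'a list set) (Q::'a list set) (f::'a list\<Rightarrow>'a) (g::'a list\<Rightarrow>'a).
      finite P \<Longrightarrow> finite Q \<Longrightarrow> f ` P \<subseteq> U \<Longrightarrow> g ` Q \<subseteq> U \<Longrightarrow>
      (\<And>v. real (card {p\<in>P. f p = v}) \<le> \<delta> * real (card P)) \<Longrightarrow>
      (\<And>v. real (card {q\<in>Q. g q = v}) \<le> \<delta> * real (card Q)) \<Longrightarrow>
      real (card {(p, q) \<in> P \<times> Q. adj (f p) (g q)}) \<le> \<epsilon> * real (card P) * real (card Q)"
    and "\<delta> > 0" "\<delta> \<le> \<epsilon>"
    and \<eta>: "\<And>j. 1 \<le> j \<Longrightarrow> j < k \<Longrightarrow> (\<Sum>x\<in>U. b j x * b (k - j) x) \<le> \<eta> * T k"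
    and ij: "i + 2 \<le> j" "j + 2 \<le> i + 2 * k" "j < 2 * k"
  shows "real (card {xs \<in> closed_walks (2 * k). xs ! i = xs ! j \<or> adj (xs ! i) (xs ! j)})
    \<le> (2 * \<epsilon> + 2 * \<eta> / \<delta>\<^sup>2) * T k"
proof -
  text \<open>After a rotation, the positions i and j lie strictly inside the two halves of the walk.\<close>
  define a where "a = k - (j - i)"
  define c where "c = (j - i) - k"
  \<comment> \<open>The summand 2k is invisible modulo the length and keeps the subtraction from
    truncating.\<close>
  define r where "r = i + 2 * k - a"
  \<comment> \<open>By truncation at least one of \<open>a\<close> and \<open>c\<close> is 0. A gap
    of at least 2 keeps \<open>a\<close> below \<open>k - 1\<close>, and a gap of at most 2k - 2
    does the same for \<open>c\<close>.\<close>
  have ac: "a + 1 < k" "c + 1 < k" "k + c = a + (j - i)" using ij by (auto simp: a_def c_def)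
  then have k: "k > 0" by simp
  define S where "S ps qs \<longleftrightarrow> ps ! a = qs ! c \<or> adj (ps ! a) (qs ! c)" for ps qs
  have "rotate r ` {xs \<in> closed_walks (2 * k). xs ! i = xs ! j \<or> adj (xs ! i) (xs ! j)}
      \<subseteq> {xs \<in> closed_walks (2 * k). S (take k xs) (drop k xs)}"
  proof clarsimp
    fix xs assume xs: "xs \<in> closed_walks (2 * k)" "xs ! i = xs ! j \<or> adj (xs ! i) (xs ! j)"
    have len: "length xs = 2 * k" using xs(1) by (simp add: closed_walks_def)
    have "(r + a) mod (2 * k) = i" "(r + (k + c)) mod (2 * k) = j"
    proof -
      have eq: "r + a = i + 2 * k" "r + (k + c) = j + 2 * k" using ac ij by (auto simp: r_def)
      show "(r + a) mod (2 * k) = i" "(r + (k + c)) mod (2 * k) = j"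
        unfolding eq using ij by simp_all
    qed
    then have "rotate r xs ! a = xs ! i" "rotate r xs ! (k + c) = xs ! j"
      using len ac by (simp_all add: nth_rotate)
    then have "S (take k (rotate r xs)) (drop k (rotate r xs))"
      using xs(2) len ac by (simp add: S_def)
    with xs(1) show "rotate r xs \<in> closed_walks (2 * k) \<and> S (take k (rotate r xs)) (drop k (rotate r xs))"
      by (simp add: rotate_closed_walks)
  qed
  then have "card {xs \<in> closed_walks (2 * k). xs ! i = xs ! j \<or> adj (xs ! i) (xs ! j)}
      \<le> card {xs \<in> closed_walks (2 * k). S (take k xs) (drop k xs)}"
    using finite_closed_walks
    by (intro card_inj_on_le[of "rotate r"]) (auto simp: inj_on_def rotate_def inj_eq[OF inj_fn[OF inj_rotate1]])
  then have "real (card {xs \<in> closed_walks (2 * k). xs ! i = xs ! j \<or> adj (xs ! i) (xs ! j)})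
      \<le> (\<Sum>x\<in>U. \<Sum>y\<in>U. real (card {(ps, qs) \<in> walks k x y \<times> walks k y x. S ps qs}))"
    using card_closed_walks_split[OF k, of S] by simp
  also have "\<dots> \<le> (\<Sum>x\<in>U. \<Sum>y\<in>U. 2 * \<epsilon> * (N k x y)\<^sup>2 +
      1 / \<delta>\<^sup>2 * ((\<Sum>v\<in>U. (N (Suc a) x v * N (k - Suc a) v y)\<^sup>2) +
        (\<Sum>v\<in>U. (N (k - Suc c) x v * N (Suc c) v y)\<^sup>2)))"
    unfolding S_def by (intro sum_mono) (rule card_walk_pairs_le[OF KST assms(2,3) ac(1,2)])
  also have "\<dots> = 2 * \<epsilon> * T k + 1 / \<delta>\<^sup>2 *
      ((\<Sum>x\<in>U. \<Sum>y\<in>U. \<Sum>v\<in>U. (N (Suc a) x v * N (k - Suc a) v y)\<^sup>2) +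
       (\<Sum>x\<in>U. \<Sum>y\<in>U. \<Sum>v\<in>U. (N (k - Suc c) x v * N (Suc c) v y)\<^sup>2))"
    by (simp only: T_eq sum.distrib sum.cartesian_product[symmetric] flip: sum_distrib_left)
  also have "\<dots> = 2 * \<epsilon> * T k + 1 / \<delta>\<^sup>2 *
      ((\<Sum>v\<in>U. b (Suc a) v * b (k - Suc a) v) + (\<Sum>v\<in>U. b (k - Suc c) v * b (Suc c) v))"
  proof -
    \<comment> \<open>Read from x, the second half meets its marked vertex after
      \<open>k - Suc c\<close> steps, so the identity is applied at the reflected index.\<close>
    have "Suc (k - Suc c - 1) = k - Suc c" "k - (k - Suc c) = Suc c" using ac by auto
    with sum_through_sq[of "k - Suc c - 1" k] ac
    have "(\<Sum>x\<in>U. \<Sum>y\<in>U. \<Sum>v\<in>U. (N (k - Suc c) x v * N (Suc c) v y)\<^sup>2) =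
        (\<Sum>v\<in>U. b (k - Suc c) v * b (Suc c) v)"
      by (metis Suc_le_eq diff_le_self)
    then show ?thesis using sum_through_sq[of a k] ac by simp
  qed
  also have "\<dots> \<le> 2 * \<epsilon> * T k + 1 / \<delta>\<^sup>2 * (\<eta> * T k + \<eta> * T k)"
    using \<eta>[of "Suc a"] \<eta>[of "Suc c"] ac assms(2,3)
    by (intro add_mono mult_left_mono) (auto simp: mult.commute)
  also have "\<dots> = (2 * \<epsilon> + 2 * \<eta> / \<delta>\<^sup>2) * T k" by (simp add: algebra_simps)
  finally show ?thesis .
qed

end

text \<open>A union bound over all pairs of positions at cyclic distance at least 2. The threshold
  \<open>\<eta>\<close> precedes all graph data, and \<open>\<nu>\<close> stands for the k-th root
  of the number of vertices.\<close>

lemma exists_induced_closed_walk: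
  fixes k s :: nat
  assumes "k \<ge> 2" and "s \<ge> 1"
  shows "\<exists>\<eta>>0. \<forall>(U::'a set) adj \<theta> \<Delta> \<nu>. fin_graph U adj \<longrightarrow>
    \<not> (\<exists>A B. A \<subseteq> U \<and> B \<subseteq> U \<and> card A = s \<and> card B = s \<and> (\<forall>a\<in>A. \<forall>b\<in>B. adj a b)) \<longrightarrow>
    U \<noteq> {} \<longrightarrow> \<theta> > 0 \<longrightarrow>
    (\<forall>x\<in>U. \<theta> \<le> real (card {y. adj x y}) \<and> real (card {y. adj x y}) \<le> \<Delta>) \<longrightarrow>
    \<nu> \<ge> 0 \<longrightarrow> \<nu> ^ k = real (card U) \<longrightarrow> \<Delta> * \<nu> \<le> \<eta> * \<theta>\<^sup>2 \<longrightarrow>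
    (\<exists>xs. length xs = 2 * k \<and> (\<forall>i<2 * k. adj (xs ! i) (xs ! (Suc i mod (2 * k)))) \<and>
      (\<forall>i j. i + 2 \<le> j \<longrightarrow> j + 2 \<le> i + 2 * k \<longrightarrow> j < 2 * k \<longrightarrow> xs ! i \<noteq> xs ! j \<and> \<not> adj (xs ! i) (xs ! j)))"
proof -
  \<comment> \<open>With this choice and that of \<open>\<eta>\<close> below, each pair of positions
    spoils at most a 1/(8k^2) fraction of the closed walks; at most 4k^2 pairs spoil at most
    half.\<close>
  define \<epsilon> :: real where "\<epsilon> = 1 / (32 * (real k)\<^sup>2)"
  have \<epsilon>: "\<epsilon> > 0" using assms by (simp add: \<epsilon>_def)
  obtain \<delta>' where \<delta>': "\<delta>' > 0" and KST': "\<forall>(P::'a list set) (Q::'a list set) (f::'a list\<Rightarrow>'a) (g::'a list\<Rightarrow>'a) R.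
    finite P \<longrightarrow> finite Q \<longrightarrow>
    (\<forall>v. real (card {p\<in>P. f p = v}) \<le> \<delta>' * real (card P)) \<longrightarrow>
    (\<forall>v. real (card {q\<in>Q. g q = v}) \<le> \<delta>' * real (card Q)) \<longrightarrow>
    \<not> (\<exists>A B. A \<subseteq> f ` P \<and> B \<subseteq> g ` Q \<and> card A = s \<and> card B = s \<and> (\<forall>a\<in>A. \<forall>b\<in>B. R a b)) \<longrightarrow>
    real (card {(p, q) \<in> P \<times> Q. R (f p) (g q)}) \<le> \<epsilon> * real (card P) * real (card Q)"
    by (rule exE[OF Kovari_Sos_Turan_fibres[OF \<epsilon> assms(2)]]) (elim conjE, rule that)
  \<comment> \<open>Shrinking \<open>\<delta>'\<close> only strengthens the condition on fibres, so
    the adjacency bound survives.\<close>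
  define \<delta> where "\<delta> = min \<delta>' \<epsilon>"
  have \<delta>: "\<delta> > 0" "\<delta> \<le> \<epsilon>" "\<delta> \<le> \<delta>'" using \<delta>' \<epsilon> by (simp_all add: \<delta>_def)
  define \<eta> where "\<eta> = \<delta>\<^sup>2 / (32 * (real k)\<^sup>2)"
  have "\<eta> > 0" using \<delta> assms by (simp add: \<eta>_def)
  have goal: "\<exists>xs. length xs = 2 * k \<and> (\<forall>i<2 * k. adj (xs ! i) (xs ! (Suc i mod (2 * k)))) \<and>
      (\<forall>i j. i + 2 \<le> j \<longrightarrow> j + 2 \<le> i + 2 * k \<longrightarrow> j < 2 * k \<longrightarrow> xs ! i \<noteq> xs ! j \<and> \<not> adj (xs ! i) (xs ! j))"
    if G: "fin_graph U adj"
      and noK: "\<not> (\<exists>A B. A \<subseteq> U \<and> B \<subseteq> U \<and> card A = s \<and> card B = s \<and> (\<forall>a\<in>A. \<forall>b\<in>B. adj a b))"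
      and U: "U \<noteq> {}" and \<theta>: "\<theta> > 0"
      and deg: "\<forall>x\<in>U. \<theta> \<le> real (card {y. adj x y}) \<and> real (card {y. adj x y}) \<le> \<Delta>"
      and \<nu>: "\<nu> \<ge> 0" "\<nu> ^ k = real (card U)" and \<eta>_ge: "\<Delta> * \<nu> \<le> \<eta> * \<theta>\<^sup>2"
    for U :: "'a set" and adj \<theta> \<Delta> \<nu>
  proof -
    interpret fin_graph U adj by (rule G)
    have deg': "\<theta> \<le> real (deg x)" "real (deg x) \<le> \<Delta>" if "x \<in> U" for x
      using deg that by (simp_all add: deg_def)
    have "0 < \<theta> ^ (2 * k)" using \<theta> by simp
    also have "\<dots> \<le> T k" using T_ge[of \<theta> k] deg'(1) \<theta> U by simp
    finally have T_pos: "T k > 0" .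
    have few: "(\<Sum>x\<in>U. b j x * b (k - j) x) \<le> \<eta> * T k" if "1 \<le> j" "j < k" for j
    proof -
      have "\<theta>\<^sup>2 * (\<Sum>x\<in>U. b j x * b (k - j) x) \<le> \<Delta> * \<nu> * T k"
        using deg' \<theta> U that \<nu> by (rule sum_b_mult_le)
      also have "\<dots> \<le> \<eta> * \<theta>\<^sup>2 * T k" using \<eta>_ge T_pos by (intro mult_right_mono) auto
      finally have "\<theta>\<^sup>2 * (\<Sum>x\<in>U. b j x * b (k - j) x) \<le> \<theta>\<^sup>2 * (\<eta> * T k)" by (simp add: ac_simps)
      then show ?thesis using \<theta> by simp
    qed
    have KST: "real (card {(p, q) \<in> P \<times> Q. adj (f p) (g q)}) \<le> \<epsilon> * real (card P) * real (card Q)"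
      if "finite P" "finite Q" "f ` P \<subseteq> U" "g ` Q \<subseteq> U"
        "\<And>v. real (card {p\<in>P. f p = v}) \<le> \<delta> * real (card P)"
        "\<And>v. real (card {q\<in>Q. g q = v}) \<le> \<delta> * real (card Q)"
      for P Q :: "'a list set" and f g :: "'a list \<Rightarrow> 'a"
    proof -
      have le: "\<delta> * real m \<le> \<delta>' * real m" for m
        using \<delta>(3) by (intro mult_right_mono) auto
      show ?thesis
      proof (rule KST'[THEN spec, THEN spec, THEN spec, THEN spec, THEN spec, of P Q f g adj, rule_format, OF that(1,2)])
        show "real (card {p\<in>P. f p = v}) \<le> \<delta>' * real (card P)" for v
          by (rule order_trans[OF that(5) le])
        show "real (card {q\<in>Q. g q = v}) \<le> \<delta>' * real (card Q)" for v
          by (rule order_trans[OF that(6) le])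
        show "\<not> (\<exists>A B. A \<subseteq> f ` P \<and> B \<subseteq> g ` Q \<and> card A = s \<and> card B = s \<and> (\<forall>a\<in>A. \<forall>b\<in>B. adj a b))"
        proof (intro notI, elim exE conjE)
          fix A B assume AB: "A \<subseteq> f ` P" "B \<subseteq> g ` Q" "card A = s" "card B = s"
            "\<forall>a\<in>A. \<forall>b\<in>B. adj a b"
          from AB(1) that(3) have "A \<subseteq> U" by (rule subset_trans)
          moreover from AB(2) that(4) have "B \<subseteq> U" by (rule subset_trans)
          ultimately show False using noK AB(3-5) by blast
        qed
      qed
    qed
    define bad where "bad = (\<lambda>(i, j). {xs \<in> closed_walks (2 * k). xs ! i = xs ! j \<or> adj (xs ! i) (xs ! j)})"
    define J where "J = {(i, j). i + 2 \<le> j \<and> j + 2 \<le> i + 2 * k \<and> j < 2 * k}"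
    have J_sub: "J \<subseteq> {..<2 * k} \<times> {..<2 * k}" by (auto simp: J_def)
    then have "finite J" by (rule finite_subset) auto
    have "card J \<le> card ({..<2 * k} \<times> {..<2 * k})" using J_sub by (intro card_mono) auto
    then have "real (card J) \<le> real (4 * k\<^sup>2)"
      unfolding of_nat_le_iff by (simp add: card_cartesian_product power2_eq_square)
    then have cJ: "real (card J) \<le> 4 * (real k)\<^sup>2" by simp
    have "real (card (\<Union>(bad ` J))) \<le> (\<Sum>p\<in>J. real (card (bad p)))"
      using card_UN_le[OF \<open>finite J\<close>, of bad] by (metis of_nat_le_iff of_nat_sum)
    also have "\<dots> \<le> (\<Sum>p\<in>J. (2 * \<epsilon> + 2 * \<eta> / \<delta>\<^sup>2) * T k)"
    proof (rule sum_mono)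
      fix p assume "p \<in> J"
      then obtain i j where p: "p = (i, j)" and ij: "i + 2 \<le> j" "j + 2 \<le> i + 2 * k" "j < 2 * k"
        by (auto simp: J_def)
      show "real (card (bad p)) \<le> (2 * \<epsilon> + 2 * \<eta> / \<delta>\<^sup>2) * T k"
        unfolding bad_def p prod.case by (rule card_bad_closed_walks_le[OF KST \<delta>(1,2) few ij])
    qed
    also have "\<dots> = real (card J) * (1 / (8 * (real k)\<^sup>2)) * T k"
      using \<delta> by (simp add: \<epsilon>_def \<eta>_def field_simps)
    also have "\<dots> \<le> 4 * (real k)\<^sup>2 * (1 / (8 * (real k)\<^sup>2)) * T k"
      using cJ T_pos by (intro mult_right_mono) auto
    also have "\<dots> < T k" using assms T_pos by simp
    also have "T k = real (card (closed_walks (2 * k)))"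
      using assms card_closed_walks[of k] by simp
    finally have "card (\<Union>(bad ` J)) < card (closed_walks (2 * k))" by simp
    moreover have "finite (\<Union>(bad ` J))"
      using \<open>finite J\<close> finite_closed_walks by (auto simp: bad_def)
    ultimately have "\<not> closed_walks (2 * k) \<subseteq> \<Union>(bad ` J)" using card_mono by (metis not_le)
    then obtain xs where xs: "xs \<in> closed_walks (2 * k)" "xs \<notin> \<Union>(bad ` J)" by blast
    have "xs ! i \<noteq> xs ! j \<and> \<not> adj (xs ! i) (xs ! j)"
      if "i + 2 \<le> j" "j + 2 \<le> i + 2 * k" "j < 2 * k" for i j
      using that xs by (force simp: bad_def J_def)
    with xs(1) show ?thesis unfolding closed_walks_def by blast
  qed
  show ?thesis
    by (intro exI[of _ \<eta>] conjI allI impI \<open>\<eta> > 0\<close>) (rule goal; assumption)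
qed

subsection \<open>Almost regular induced subgraphs\<close>

definition edges_in :: "'a set set \<Rightarrow> 'a set \<Rightarrow> 'a set set" where
  "edges_in E S = {f\<in>E. f \<subseteq> S}"

text \<open>Counting edges rather than neighbours makes the loss from deleting a vertex and the
  handshake count immediate; \<open>inc_eq_card_nbrs\<close> translates to degrees.\<close>

definition inc :: "'a set set \<Rightarrow> 'a set \<Rightarrow> 'a \<Rightarrow> nat" where
  "inc E S x = card {f\<in>edges_in E S. x \<in> f}"

lemma simple_graph_finite_edges: "simple_graph V E \<Longrightarrow> finite E"
  by (rule finite_subset[of _ "Pow V"]) (auto simp: simple_graph_def)

lemma finite_edges_in: "finite E \<Longrightarrow> finite (edges_in E S)"
  by (simp add: edges_in_def)

lemma simple_graph_edgeE:
  assumes "simple_graph V E" and "f \<in> E"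
  obtains u v where "u \<in> V" "v \<in> V" "u \<noteq> v" "f = {u, v}"
  using assms by (auto simp: simple_graph_def)

lemma sum_inc:
  assumes "simple_graph V E" and "S \<subseteq> V"
  shows "(\<Sum>x\<in>S. inc E S x) = 2 * card (edges_in E S)"
proof -
  have fin: "finite S" "finite (edges_in E S)"
    using assms finite_subset finite_edges_in[OF simple_graph_finite_edges[OF assms(1)]]
    by (auto simp: simple_graph_def)
  have "(\<Sum>x\<in>S. inc E S x) = (\<Sum>f\<in>edges_in E S. card {x\<in>S. x \<in> f})"
    unfolding inc_def
    using sum.swap_restrict[OF fin, of "\<lambda>_ _. 1::nat" "\<lambda>x f. x \<in> f"] by simp
  also have "\<dots> = (\<Sum>f\<in>edges_in E S. 2)"
  proof (rule sum.cong[OF refl])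
    fix f assume f: "f \<in> edges_in E S"
    then have "f \<in> E" by (simp add: edges_in_def)
    with assms(1) obtain u v where "u \<noteq> v" "f = {u, v}" by (rule simple_graph_edgeE)
    moreover from this f have "{x\<in>S. x \<in> f} = {u, v}" by (auto simp: edges_in_def)
    ultimately show "card {x\<in>S. x \<in> f} = 2" by simp
  qed
  finally show ?thesis by simp
qed

lemma inc_eq_card_nbrs:
  assumes "simple_graph V E" and "x \<in> S"
  shows "inc E S x = card {y\<in>S. {x, y} \<in> E}"
proof -
  have "bij_betw (\<lambda>y. {x, y}) {y\<in>S. {x, y} \<in> E} {f\<in>edges_in E S. x \<in> f}"
    unfolding bij_betw_def
  proof
    show "inj_on (\<lambda>y. {x, y}) {y\<in>S. {x, y} \<in> E}"
      by (auto simp: inj_on_def doubleton_eq_iff)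
    show "(\<lambda>y. {x, y}) ` {y\<in>S. {x, y} \<in> E} = {f\<in>edges_in E S. x \<in> f}"
    proof (intro equalityI subsetI)
      fix f assume f: "f \<in> {f\<in>edges_in E S. x \<in> f}"
      then have "f \<in> E" by (simp add: edges_in_def)
      with assms(1) obtain u v where "u \<noteq> v" "f = {u, v}" by (rule simple_graph_edgeE)
      then obtain y where "f = {x, y}" using f by (auto simp: doubleton_eq_iff)
      with f show "f \<in> (\<lambda>y. {x, y}) ` {y\<in>S. {x, y} \<in> E}" by (auto simp: edges_in_def)
    qed (use assms in \<open>auto simp: edges_in_def\<close>)
  qed
  then show ?thesis unfolding inc_def by (rule bij_betw_same_card[symmetric])
qed

lemma inc_le_card:
  assumes "simple_graph V E" and "finite S" and "x \<in> S"
  shows "inc E S x \<le> card S"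
  unfolding inc_eq_card_nbrs[OF assms(1,3)] using assms(2) by (intro card_mono) auto

lemma inc_mono:
  assumes "finite E" and "S \<subseteq> S'"
  shows "inc E S x \<le> inc E S' x"
  unfolding inc_def using assms by (intro card_mono) (auto simp: edges_in_def)

lemma card_edges_in_remove:
  assumes "finite E"
  shows "card (edges_in E (S - {x})) + inc E S x = card (edges_in E S)"
proof -
  have "edges_in E S = edges_in E (S - {x}) \<union> {f\<in>edges_in E S. x \<in> f}"
    "edges_in E (S - {x}) \<inter> {f\<in>edges_in E S. x \<in> f} = {}"
    by (auto simp: edges_in_def)
  then show ?thesis
    unfolding inc_def using assms
    by (metis (no_types, lifting) card_Un_disjoint finite_Un finite_edges_in)
qed

text \<open>Within a residue class the quotient determines the number, and the quotients lie between
  0 and \<open>n div p\<close>.\<close>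

lemma card_mod_class_le: "card {m\<in>{..<n}. m mod p = i} \<le> n div p + 1"
proof -
  have "inj_on (\<lambda>m. m div p) {m\<in>{..<n}. m mod p = i}"
    by (rule inj_onI) (metis (mono_tags, lifting) div_mult_mod_eq mem_Collect_eq)
  moreover have "(\<lambda>m. m div p) ` {m\<in>{..<n}. m mod p = i} \<subseteq> {..n div p}"
    by (auto intro: div_le_mono)
  ultimately have "card {m\<in>{..<n}. m mod p = i} \<le> card {..n div p}"
    by (intro card_inj_on_le) auto
  then show ?thesis by simp
qed

lemma exists_balanced_partition:
  fixes W :: "'a set" and p :: nat
  assumes "finite W" and "p > 0"
  obtains h :: "'a \<Rightarrow> nat" where "\<And>x. h x < p" "\<And>i. card {x\<in>W. h x = i} \<le> card W div p + 1"
proof -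
  obtain g where g: "bij_betw g W {..<card W}"
    using assms(1) by (metis atLeast0LessThan ex_bij_betw_finite_nat)
  have "card {x\<in>W. g x mod p = i} \<le> card {m\<in>{..<card W}. m mod p = i}" for i
    using g by (intro card_inj_on_le[of g]) (auto simp: bij_betw_def inj_on_def)
  then show ?thesis
    using assms(2) card_mod_class_le[of "card W" p] order_trans
    by (intro that[of "\<lambda>x. g x mod p"]) (auto intro: order_trans)
qed

lemma finite_exists_max:
  fixes f :: "'b \<Rightarrow> real"
  assumes "finite A" and "A \<noteq> {}"
  obtains a where "a \<in> A" "\<And>x. x \<in> A \<Longrightarrow> f x \<le> f a"
proof -
  have "Max (f ` A) \<in> f ` A" using assms by (intro Max_in) auto
  then obtain a where "a \<in> A" "Max (f ` A) = f a" by auto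
  with assms show ?thesis by (intro that[of a]) (auto intro: Max_ge simp flip: \<open>Max (f ` A) = f a\<close>)
qed

text \<open>
  The set W maximises the density e(S) / |S|^(1+1/k). By maximality, the vertices of W of degree
  much larger than average meet at most half of the edges: otherwise these vertices together with
  one of p equal parts of W would span a denser graph.
\<close>

lemma exists_almost_regular_subgraph:
  fixes k :: nat and C :: real and V :: "'a set"
  assumes G: "simple_graph V E" and k: "k \<ge> 1" and C: "C \<ge> 33 ^ k"
    and e: "real (card E) > C * real (card V) powr (1 + 1 / real k)"
  obtains U \<theta> where "U \<subseteq> V" "U \<noteq> {}" "\<theta> > 0"
    "\<And>x. x \<in> U \<Longrightarrow> \<theta> \<le> real (card {y\<in>U. {x, y} \<in> E})"
    "\<And>x. x \<in> U \<Longrightarrow> real (card {y\<in>U. {x, y} \<in> E}) \<le> 4 * 33 ^ k * \<theta>"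
    "C / 4 * real (card U) powr (1 / real k) \<le> \<theta>"
proof -
  define \<alpha> where "\<alpha> = 1 + 1 / real k"
  define es where "es S = real (card (edges_in E S))" for S
  have fE: "finite E" using G by (rule simple_graph_finite_edges)
  have fV: "finite V" using G by (simp add: simple_graph_def)
  have C_pos: "C > 0" using C by (rule less_le_trans[rotated]) simp
  have no_edges: "edges_in E {} = {}" using G by (auto simp: edges_in_def simple_graph_def)
  have EV: "edges_in E V = E" using G by (auto simp: edges_in_def simple_graph_def)
  have "E \<noteq> {}" using e C_pos by (auto simp: mult_less_0_iff)
  then have "V \<noteq> {}" using G by (fastforce simp: simple_graph_def)
  have "finite (Pow V - {{}})" "Pow V - {{}} \<noteq> {}" using fV \<open>V \<noteq> {}\<close> by auto
  then obtain W where W: "W \<in> Pow V - {{}}"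
    and max: "\<And>S. S \<in> Pow V - {{}} \<Longrightarrow> es S / real (card S) powr \<alpha> \<le> es W / real (card W) powr \<alpha>"
    by (rule finite_exists_max[where f = "\<lambda>S. es S / real (card S) powr \<alpha>"]) blast
  define c where "c = es W / real (card W) powr \<alpha>"
  define n where "n = real (card W)"
  have fin: "finite S" if "S \<subseteq> V" for S using that fV finite_subset by blast
  have WV: "W \<subseteq> V" "W \<noteq> {}" using W by auto
  have n_pos: "n > 0" using WV fin by (simp add: n_def card_gt_0_iff)
  have es_W: "es W = c * n powr \<alpha>" using n_pos by (simp add: c_def n_def)
  have es_le: "es S \<le> c * real (card S) powr \<alpha>" if "S \<subseteq> V" for S
  proof (cases "S = {}")
    case True
    then show ?thesis by (simp add: es_def no_edges)
  next
    case False
    then have "real (card S) powr \<alpha> > 0" using fin[OF that] by (simp add: card_gt_0_iff)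
    then show ?thesis using max[of S] False that by (simp add: c_def pos_divide_le_eq)
  qed
  have "C < es V / real (card V) powr \<alpha>"
    using e fV \<open>V \<noteq> {}\<close> by (simp add: es_def EV \<alpha>_def pos_less_divide_eq card_gt_0_iff)
  also have "\<dots> \<le> c" unfolding c_def using \<open>V \<noteq> {}\<close> by (intro max) auto
  finally have Cc: "C < c" .
  have n_powr: "n powr \<alpha> = n * n powr (1 / real k)"
    using n_pos by (simp add: \<alpha>_def powr_add)
  have es_pos: "es W > 0" unfolding es_W using Cc C_pos n_pos by simp
  have sum_inc_W: "(\<Sum>x\<in>W. real (inc E W x)) = 2 * es W"
    using sum_inc[OF G WV(1)] unfolding es_def by (metis of_nat_mult of_nat_numeral of_nat_sum)
  \<comment> \<open>The exponent k gives p^(1/k) = 33. Each of \<open>p\<close> pieces has at most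
    4n/p vertices, and 4^\<alpha> \<le> 16, so together they span at most 16/33 of the edges: 33 is
    the least integer that makes this less than one half.\<close>
  define p :: nat where "p = 33 ^ k"
  have p_pos: "p > 0" by (simp add: p_def)
  \<comment> \<open>The average degree in \<open>W\<close> cannot exceed \<open>n\<close>, while it
    is at least 2c with c > C \<ge> p. This absorbs the rounding term 1 in the part sizes.\<close>
  have "n \<ge> real p"
  proof -
    have "2 * es W \<le> (\<Sum>x\<in>W. n)"
      unfolding sum_inc_W[symmetric] n_def
      by (intro sum_mono) (use inc_le_card[OF G fin[OF WV(1)]] in simp)
    then have "2 * (c * n powr (1 / real k)) * n \<le> n * n"
      by (simp add: es_W n_powr mult.assoc mult.commute mult.left_commute flip: n_def)
    then have "2 * (c * n powr (1 / real k)) \<le> n" using n_pos by simp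
    moreover have "n powr (1 / real k) \<ge> 1"
      using n_pos by (intro ge_one_powr_ge_zero) (simp_all add: n_def)
    then have "c \<le> c * n powr (1 / real k)" using Cc C_pos by (simp add: mult_le_cancel_left1)
    moreover have "real p = 33 ^ k" by (simp add: p_def)
    ultimately show ?thesis using Cc C C_pos by linarith
  qed
  define B where "B = {x\<in>W. real (inc E W x) > real p * es W / n}"
  have BW: "B \<subseteq> W" by (auto simp: B_def)
  have cB: "real (card B) \<le> 2 * n / real p"
  proof -
    have "real (card B) * (real p * es W / n) = (\<Sum>x\<in>B. real p * es W / n)" by simp
    also have "\<dots> \<le> (\<Sum>x\<in>B. real (inc E W x))" by (intro sum_mono) (simp add: B_def)
    also have "\<dots> \<le> (\<Sum>x\<in>W. real (inc E W x))"
      using BW WV fin by (intro sum_mono2) auto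
    finally have "(real (card B) * real p / n) * es W \<le> 2 * es W" by (simp add: sum_inc_W)
    then have "real (card B) * real p / n \<le> 2" using es_pos by (simp only: mult_le_cancel_right)
    then show ?thesis using n_pos p_pos by (simp add: field_simps)
  qed
  obtain h :: "'a \<Rightarrow> nat" where h: "\<And>x. h x < p" "\<And>i. card {x\<in>W. h x = i} \<le> card W div p + 1"
    using exists_balanced_partition[OF fin[OF WV(1)] p_pos] by blast
  define S where "S i = B \<union> {x\<in>W. h x = i}" for i
  have SV: "S i \<subseteq> V" for i using BW WV by (auto simp: S_def)
  have cS: "real (card (S i)) \<le> 4 * n / real p" for i
  proof -
    have "real (card (S i)) \<le> real (card B) + real (card {x\<in>W. h x = i})"
      unfolding S_def using card_Un_le[of B "{x\<in>W. h x = i}"] by linarith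
    also have "real (card {x\<in>W. h x = i}) \<le> real (card W div p) + 1" using h(2)[of i] by linarith
    also have "real (card W div p) \<le> n / real p" unfolding n_def by (rule of_nat_div_le_of_nat)
    also have "1 \<le> n / real p" using \<open>n \<ge> real p\<close> p_pos by simp
    finally show ?thesis using cB by simp
  qed
  define F where "F = {f\<in>edges_in E W. f \<inter> B \<noteq> {}}"
  have "real (card F) \<le> es W / 2"
  proof -
    \<comment> \<open>An edge with one end in \<open>B\<close> lies inside \<open>B\<close> together
      with the part of its other end.\<close>
    have "F \<subseteq> (\<Union>i<p. edges_in E (S i))"
    proof
      fix f assume f: "f \<in> F"
      then have "f \<in> E" by (simp add: F_def edges_in_def)
      with G obtain u v where "f = {u, v}" by (rule simple_graph_edgeE)
      then obtain u v where uv: "f = {u, v}" "u \<in> B" using f by (fastforce simp: F_def)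
      then have "f \<in> edges_in E (S (h v))" using f by (auto simp: F_def edges_in_def S_def)
      then show "f \<in> (\<Union>i<p. edges_in E (S i))" using h(1) by blast
    qed
    then have "card F \<le> card (\<Union>i<p. edges_in E (S i))"
      by (intro card_mono) (auto simp: finite_edges_in fE)
    also have "\<dots> \<le> (\<Sum>i<p. card (edges_in E (S i)))" by (rule card_UN_le) simp
    finally have "real (card F) \<le> (\<Sum>i<p. es (S i))"
      unfolding es_def of_nat_sum[symmetric] of_nat_le_iff .
    also have "\<dots> \<le> (\<Sum>i<p. c * (4 * n / real p) powr \<alpha>)"
    proof (rule sum_mono)
      fix i
      have "es (S i) \<le> c * real (card (S i)) powr \<alpha>" by (rule es_le[OF SV])
      also have "\<dots> \<le> c * (4 * n / real p) powr \<alpha>"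
        using Cc C_pos cS by (intro mult_left_mono powr_mono2) (auto simp: \<alpha>_def)
      finally show "es (S i) \<le> c * (4 * n / real p) powr \<alpha>" .
    qed
    also have "\<dots> = real p * (4 powr \<alpha> / real p powr \<alpha>) * es W"
      using n_pos p_pos by (simp add: es_W powr_mult powr_divide)
    also have "real p powr \<alpha> = real p * 33"
    proof -
      have "real p powr (1 / real k) = 33"
        using k by (simp add: p_def powr_powr flip: powr_realpow)
      then show ?thesis using p_pos by (simp add: \<alpha>_def powr_add)
    qed
    also have "4 powr \<alpha> \<le> 4 powr (2::real)"
      using k by (intro powr_mono) (auto simp: \<alpha>_def)
    also have "4 powr (2::real) = 16" by simp
    finally have "real (card F) \<le> real p * (16 / (real p * 33)) * es W"
      using p_pos es_pos by (simp add: divide_right_mono mult_right_mono)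
    also have "\<dots> = 16 / 33 * es W" using p_pos by simp
    also have "\<dots> \<le> es W / 2" using es_pos by simp
    finally show ?thesis .
  qed
  moreover have "es W = es (W - B) + real (card F)"
  proof -
    have "edges_in E W = edges_in E (W - B) \<union> F" "edges_in E (W - B) \<inter> F = {}"
      by (auto simp: edges_in_def F_def)
    then show ?thesis
      unfolding es_def using fE by (metis card_Un_disjoint finite_Un finite_edges_in of_nat_add)
  qed
  ultimately have half: "es (W - B) \<ge> es W / 2" by simp
  \<comment> \<open>One eighth of the average degree in \<open>W\<close>: the penalty \<theta> |W -
    B| is then at most a quarter of the edges, less than the half that \<open>W - B\<close>
    retains.\<close>
  define \<theta> where "\<theta> = es W / (4 * n)"
  have \<theta>_pos: "\<theta> > 0" using es_pos n_pos by (simp add: \<theta>_def)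
  have "finite (Pow (W - B))" "Pow (W - B) \<noteq> {}" using fin[OF WV(1)] by auto
  \<comment> \<open>This maximum replaces repeated deletion of low-degree vertices: removing a
    vertex of degree below \<open>\<theta>\<close> would increase the value. Positivity at
    \<open>W - B\<close> excludes the empty set.\<close>
  then obtain U where U: "U \<in> Pow (W - B)"
    and maxU: "\<And>S. S \<in> Pow (W - B) \<Longrightarrow> es S - \<theta> * real (card S) \<le> es U - \<theta> * real (card U)"
    by (rule finite_exists_max[where f = "\<lambda>S. es S - \<theta> * real (card S)"]) blast
  have UW: "U \<subseteq> W" "U \<inter> B = {}" using U by auto
  have UV: "U \<subseteq> V" using UW WV by blast
  have "real (card (W - B)) \<le> n"
    unfolding n_def using fin[OF WV(1)] by (simp add: card_mono)
  then have "\<theta> * real (card (W - B)) \<le> es W / 4"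
    using \<theta>_pos n_pos mult_left_mono[of _ n \<theta>] by (fastforce simp: \<theta>_def)
  then have "es U - \<theta> * real (card U) > 0"
    using maxU[of "W - B"] half es_pos by simp
  then have "U \<noteq> {}"
    by (auto simp: es_def no_edges)
  show ?thesis
  proof (rule that[OF UV \<open>U \<noteq> {}\<close> \<theta>_pos])
    fix x assume x: "x \<in> U"
    have eq: "inc E U x = card {y\<in>U. {x, y} \<in> E}" by (rule inc_eq_card_nbrs[OF G x])
    have "es (U - {x}) - \<theta> * real (card (U - {x})) \<le> es U - \<theta> * real (card U)"
      using U by (intro maxU) auto
    moreover have "es U = es (U - {x}) + real (inc E U x)"
      unfolding es_def using card_edges_in_remove[OF fE, of U x] by linarith
    moreover have "real (card U) = real (card (U - {x})) + 1"
      using x fin[OF UV] card_Suc_Diff1[of U x] by linarith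
    ultimately show "\<theta> \<le> real (card {y\<in>U. {x, y} \<in> E})"
      unfolding eq[symmetric] by (simp add: algebra_simps)
    have "real (inc E U x) \<le> real (inc E W x)" using inc_mono[OF fE UW(1)] by simp
    also have "\<dots> \<le> real p * es W / n" using x UW by (force simp: B_def)
    also have "\<dots> = 4 * 33 ^ k * \<theta>" using n_pos by (simp add: \<theta>_def p_def)
    finally show "real (card {y\<in>U. {x, y} \<in> E}) \<le> 4 * 33 ^ k * \<theta>" unfolding eq .
  next
    have "real (card U) \<le> n" unfolding n_def using UW fin[OF WV(1)] by (simp add: card_mono)
    then have "C / 4 * real (card U) powr (1 / real k) \<le> c / 4 * n powr (1 / real k)"
      using Cc C_pos by (intro mult_mono powr_mono2) auto
    also have "\<dots> = \<theta>" using n_pos by (simp add: \<theta>_def es_W n_powr)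
    finally show "C / 4 * real (card U) powr (1 / real k) \<le> \<theta>" .
  qed
qed

subsection \<open>Induced even cycles\<close>

text \<open>The second alternative is the closing edge, which forces i = 0 and j = m - 1. In this
  form the two alternatives are the exact complement of the chord condition used for closed
  walks.\<close>

lemma cycle_E_iff:
  assumes "i < j" and "j < m" and "m \<ge> 3"
  shows "{i, j} \<in> cycle_E m \<longleftrightarrow> j = i + 1 \<or> j + 1 = i + m"
proof
  assume "{i, j} \<in> cycle_E m"
  then obtain l where l: "{i, j} = {l, Suc l mod m}" "l < m" by (auto simp: cycle_E_def)
  then show "j = i + 1 \<or> j + 1 = i + m"
    using assms by (cases "Suc l = m") (auto simp: doubleton_eq_iff)
next
  assume "j = i + 1 \<or> j + 1 = i + m"
  then show "{i, j} \<in> cycle_E m"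
  proof
    assume "j = i + 1"
    then have "{i, j} = {i, Suc i mod m}" "i < m" using assms by simp_all
    then show ?thesis unfolding cycle_E_def by blast
  next
    assume "j + 1 = i + m"
    then have "i = 0" "m = Suc j" using assms by auto
    then have "{i, j} = {j, Suc j mod m}" "j < m" by auto
    then show ?thesis unfolding cycle_E_def by blast
  qed
qed

text \<open>Injectivity has two sources: distant positions differ by the chord condition, and
  consecutive ones differ because an edge is never a singleton.\<close>

lemma contains_induced_cycleI:
  assumes "m \<ge> 3" and V: "\<And>i. i < m \<Longrightarrow> f i \<in> V"
    and edge: "\<And>i. i < m \<Longrightarrow> {f i, f (Suc i mod m)} \<in> E"
    and loopless: "\<And>v. {v} \<notin> E"
    and chordless: "\<And>i j. i + 2 \<le> j \<Longrightarrow> j + 2 \<le> i + m \<Longrightarrow> j < m \<Longrightarrow> f i \<noteq> f j \<and> {f i, f j} \<notin> E"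
  shows "contains_induced (cycle_V m) (cycle_E m) V E"
proof -
  have key: "f i \<noteq> f j \<and> ({i, j} \<in> cycle_E m \<longleftrightarrow> {f i, f j} \<in> E)" if ij: "i < j" "j < m" for i j
  proof (cases "i + 2 \<le> j \<and> j + 2 \<le> i + m")
    case True
    then have "{i, j} \<notin> cycle_E m" unfolding cycle_E_iff[OF ij assms(1)] by linarith
    with True chordless ij show ?thesis by blast
  next
    case False
    then have close: "j = i + 1 \<or> j + 1 = i + m" using ij by linarith
    have "{f i, f j} \<in> E"
    proof (cases "j = i + 1")
      case True
      then show ?thesis using edge[of i] ij by simp
    next
      case False
      with close have "i = 0" "Suc j = m" using ij by auto
      then show ?thesis using edge[of j] by (simp add: insert_commute)
    qed
    moreover from this loopless have "f i \<noteq> f j" by auto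
    ultimately show ?thesis using close cycle_E_iff[OF ij assms(1)] by blast
  qed
  have sym_key: "f i \<noteq> f j \<and> ({i, j} \<in> cycle_E m \<longleftrightarrow> {f i, f j} \<in> E)"
    if "i \<noteq> j" "i < m" "j < m" for i j
    using key[of i j] key[of j i] that by (cases "i < j") (auto simp: insert_commute)
  show ?thesis
    unfolding contains_induced_def
  proof (intro exI[of _ f] conjI)
    show "inj_on f (cycle_V m)" using sym_key by (intro inj_onI) (metis atLeastLessThan_iff cycle_V_def)
    show "f ` cycle_V m \<subseteq> V" using V by (auto simp: cycle_V_def)
    show "\<forall>u\<in>cycle_V m. \<forall>v\<in>cycle_V m. u \<noteq> v \<longrightarrow> ({u, v} \<in> cycle_E m) = ({f u, f v} \<in> E)"
      using sym_key by (simp add: cycle_V_def)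
  qed
qed

section \<open>The edge bound for a single graph\<close>

theorem induced_cycle_edge_bound:
  fixes k s :: nat
  assumes "k \<ge> 2" and "s \<ge> 2"
  shows "\<exists>C::real. \<forall>(V::'a set) E. simple_graph V E \<longrightarrow> \<not> contains_Kss V E s \<longrightarrow>
    \<not> contains_induced (cycle_V (2*k)) (cycle_E (2*k)) V E \<longrightarrow>
    real (card E) \<le> C * real (card V) powr (1 + 1 / real k)"
proof -
  have "s \<ge> 1" using assms(2) by simp
  obtain \<eta> where "\<eta> > 0" and main: "\<forall>(U::'a set) adj \<theta> \<Delta> \<nu>. fin_graph U adj \<longrightarrow>
    \<not> (\<exists>A B. A \<subseteq> U \<and> B \<subseteq> U \<and> card A = s \<and> card B = s \<and> (\<forall>a\<in>A. \<forall>b\<in>B. adj a b)) \<longrightarrow>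
    U \<noteq> {} \<longrightarrow> \<theta> > 0 \<longrightarrow>
    (\<forall>x\<in>U. \<theta> \<le> real (card {y. adj x y}) \<and> real (card {y. adj x y}) \<le> \<Delta>) \<longrightarrow>
    \<nu> \<ge> 0 \<longrightarrow> \<nu> ^ k = real (card U) \<longrightarrow> \<Delta> * \<nu> \<le> \<eta> * \<theta>\<^sup>2 \<longrightarrow>
    (\<exists>xs. length xs = 2 * k \<and> (\<forall>i<2 * k. adj (xs ! i) (xs ! (Suc i mod (2 * k)))) \<and>
      (\<forall>i j. i + 2 \<le> j \<longrightarrow> j + 2 \<le> i + 2 * k \<longrightarrow> j < 2 * k \<longrightarrow> xs ! i \<noteq> xs ! j \<and> \<not> adj (xs ! i) (xs ! j)))"
    by (rule exE[OF exists_induced_closed_walk[OF assms(1) \<open>s \<ge> 1\<close>]]) (elim conjE, rule that)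
  \<comment> \<open>The first entry is what regularisation requires. The second serves \<Delta> = 4
    * 33^k \<theta>: the density condition becomes 4 * 33^k \<nu> \<le> \<eta> \<theta>, and
    regularisation gives \<theta> \<ge> (C/4) \<nu>.\<close>
  define C :: real where "C = max (33 ^ k) (16 * 33 ^ k / \<eta>)"
  have C\<eta>: "4 * 33 ^ k \<le> \<eta> * (C / 4)"
  proof -
    have "16 * 33 ^ k / \<eta> \<le> C" by (simp add: C_def)
    then show ?thesis using \<open>\<eta> > 0\<close> by (simp add: field_simps)
  qed
  have "real (card E) \<le> C * real (card V) powr (1 + 1 / real k)"
    if G: "simple_graph V E" and noK: "\<not> contains_Kss V E s"
      and noC: "\<not> contains_induced (cycle_V (2*k)) (cycle_E (2*k)) V E"
    for V :: "'a set" and E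
  proof (rule ccontr)
    assume "\<not> ?thesis"
    then have e: "real (card E) > C * real (card V) powr (1 + 1 / real k)" by simp
    have "k \<ge> 1" "C \<ge> 33 ^ k" using assms by (simp_all add: C_def)
    from exists_almost_regular_subgraph[OF G this e] obtain U \<theta> where
      U: "U \<subseteq> V" "U \<noteq> {}" and \<theta>: "\<theta> > 0"
      and deg: "\<And>x. x \<in> U \<Longrightarrow> \<theta> \<le> real (card {y\<in>U. {x, y} \<in> E})"
        "\<And>x. x \<in> U \<Longrightarrow> real (card {y\<in>U. {x, y} \<in> E}) \<le> 4 * 33 ^ k * \<theta>"
      and \<theta>_ge: "C / 4 * real (card U) powr (1 / real k) \<le> \<theta>"
      by blast
    have loopless: "{v} \<notin> E" for v
      using G by (auto simp: simple_graph_def doubleton_eq_iff)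
    define adj where "adj x y \<longleftrightarrow> x \<in> U \<and> y \<in> U \<and> {x, y} \<in> E" for x y
    define \<nu> where "\<nu> = real (card U) powr (1 / real k)"
    have fin: "finite U" using U G finite_subset by (auto simp: simple_graph_def)
    have \<nu>: "\<nu> \<ge> 0" "\<nu> ^ k = real (card U)"
      using assms U fin by (simp_all add: \<nu>_def powr_powr card_gt_0_iff flip: powr_realpow)
    have graph: "fin_graph U adj"
      by unfold_locales (auto simp: adj_def fin insert_commute)
    have no_Kss: "\<not> (\<exists>A B. A \<subseteq> U \<and> B \<subseteq> U \<and> card A = s \<and> card B = s \<and> (\<forall>a\<in>A. \<forall>b\<in>B. adj a b))"
    proof
      assume "\<exists>A B. A \<subseteq> U \<and> B \<subseteq> U \<and> card A = s \<and> card B = s \<and> (\<forall>a\<in>A. \<forall>b\<in>B. adj a b)"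
      then obtain A B where AB: "A \<subseteq> U" "B \<subseteq> U" "card A = s" "card B = s" "\<forall>a\<in>A. \<forall>b\<in>B. {a, b} \<in> E"
        by (auto simp: adj_def)
      \<comment> \<open>A common vertex would be adjacent to itself, producing a singleton
        edge.\<close>
      moreover have "A \<inter> B = {}" using AB(5) loopless by force
      moreover have "A \<subseteq> V" "B \<subseteq> V" using AB U(1) by blast+
      ultimately show False using noK unfolding contains_Kss_def by blast
    qed
    have "{y. adj x y} = {y\<in>U. {x, y} \<in> E}" if "x \<in> U" for x
      using that by (auto simp: adj_def)
    then have degs: "\<forall>x\<in>U. \<theta> \<le> real (card {y. adj x y}) \<and> real (card {y. adj x y}) \<le> 4 * 33 ^ k * \<theta>"
      using deg by simp
    have dense: "4 * 33 ^ k * \<theta> * \<nu> \<le> \<eta> * \<theta>\<^sup>2"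
    proof -
      have "4 * 33 ^ k * \<nu> \<le> \<eta> * (C / 4) * \<nu>" using C\<eta> \<nu>(1) by (rule mult_right_mono)
      also have "\<dots> \<le> \<eta> * \<theta>" using \<theta>_ge \<open>\<eta> > 0\<close> by (simp add: \<nu>_def mult.assoc)
      finally have "4 * 33 ^ k * \<nu> * \<theta> \<le> \<eta> * \<theta> * \<theta>" using \<theta> by (intro mult_right_mono) auto
      then show ?thesis by (simp add: power2_eq_square ac_simps)
    qed
    have "\<exists>xs. length xs = 2 * k \<and> (\<forall>i<2 * k. adj (xs ! i) (xs ! (Suc i mod (2 * k)))) \<and>
      (\<forall>i j. i + 2 \<le> j \<longrightarrow> j + 2 \<le> i + 2 * k \<longrightarrow> j < 2 * k \<longrightarrow> xs ! i \<noteq> xs ! j \<and> \<not> adj (xs ! i) (xs ! j))"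
      by (rule main[THEN spec, THEN spec, THEN spec, THEN spec, THEN spec, THEN mp, THEN mp, THEN mp,
        THEN mp, THEN mp, THEN mp, THEN mp, THEN mp, OF graph no_Kss U(2) \<theta> degs \<nu> dense])
    then obtain xs where xs: "length xs = 2 * k"
        "\<And>i. i < 2 * k \<Longrightarrow> adj (xs ! i) (xs ! (Suc i mod (2 * k)))"
        "\<And>i j. i + 2 \<le> j \<Longrightarrow> j + 2 \<le> i + 2 * k \<Longrightarrow> j < 2 * k \<Longrightarrow> xs ! i \<noteq> xs ! j \<and> \<not> adj (xs ! i) (xs ! j)"
      by auto
    have in_U: "xs ! i \<in> U" if "i < 2 * k" for i using xs(2)[OF that] by (simp add: adj_def)
    have "contains_induced (cycle_V (2*k)) (cycle_E (2*k)) V E"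
    proof (rule contains_induced_cycleI[where f = "\<lambda>i. xs ! i"])
      show "3 \<le> 2 * k" using assms by simp
      show "xs ! i \<in> V" if "i < 2 * k" for i using in_U[OF that] U(1) by blast
      show "{xs ! i, xs ! (Suc i mod (2 * k))} \<in> E" if "i < 2 * k" for i
        using xs(2)[OF that] by (simp add: adj_def)
      \<comment> \<open>The relation \<open>adj\<close> sees only \<open>U\<close>; as all vertices
        of the walk lie in \<open>U\<close>, non-adjacency there is non-adjacency in
        \<open>E\<close>.\<close>
      show "xs ! i \<noteq> xs ! j \<and> {xs ! i, xs ! j} \<notin> E"
        if "i + 2 \<le> j" "j + 2 \<le> i + 2 * k" "j < 2 * k" for i j
        using xs(3)[OF that] in_U[of i] in_U[of j] that by (auto simp: adj_def)
    qed (rule loopless)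
    with noC show False by blast
  qed
  then show ?thesis by blast
qed

theorem theorem1p4:
  fixes k s :: nat
  assumes "k \<ge> 2" and "s \<ge> 2"
  shows "\<exists>C::real. \<forall>n::nat. n \<ge> 1 \<longrightarrow>
    real (ex_star n (cycle_V (2*k)) (cycle_E (2*k)) s) \<le> C * real n powr (1 + 1 / real k)"
proof -
  obtain C where C: "\<And>(V::nat set) E. simple_graph V E \<Longrightarrow> \<not> contains_Kss V E s \<Longrightarrow>
    \<not> contains_induced (cycle_V (2*k)) (cycle_E (2*k)) V E \<Longrightarrow>
    real (card E) \<le> C * real (card V) powr (1 + 1 / real k)"
    using induced_cycle_edge_bound[OF assms, where ?'a = nat] by blast
  have "real (ex_star n (cycle_V (2*k)) (cycle_E (2*k)) s) \<le> C * real n powr (1 + 1 / real k)" for n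
  proof -
    \<comment> \<open>\<open>Max\<close> is meaningful only on a finite nonempty set; the edgeless
      graph witnesses nonemptiness, since both forbidden configurations contain an edge.\<close>
    define X where "X = {card E | E. simple_graph {0..<n} E \<and>
      \<not> contains_Kss {0..<n} E s \<and> \<not> contains_induced (cycle_V (2*k)) (cycle_E (2*k)) {0..<n} E}"
    have "E \<subseteq> Pow {0..<n}" if "simple_graph {0..<n} E" for E
      using that by (auto simp: simple_graph_def)
    then have "X \<subseteq> card ` Pow (Pow {0..<n})" unfolding X_def by blast
    then have "finite X" by (rule finite_subset) simp
    have "\<not> contains_Kss {0..<n} {} s"
    proof
      assume "contains_Kss {0..<n} {} s"
      then obtain A B :: "nat set" where "card A = s" "card B = s" "\<forall>a\<in>A. \<forall>b\<in>B. {a, b} \<in> {}"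
        unfolding contains_Kss_def by blast
      moreover from this assms(2) have "A \<noteq> {}" "B \<noteq> {}" by auto
      ultimately show False by auto
    qed
    moreover have "\<not> contains_induced (cycle_V (2*k)) (cycle_E (2*k)) {0..<n} {}"
    proof
      assume "contains_induced (cycle_V (2*k)) (cycle_E (2*k)) {0..<n} {}"
      then have "{0, 1} \<notin> cycle_E (2*k)"
        using assms(1) unfolding contains_induced_def cycle_V_def by fastforce
      then show False using cycle_E_iff[of 0 1 "2 * k"] assms(1) by simp
    qed
    moreover have "simple_graph {0..<n} {}" by (simp add: simple_graph_def)
    ultimately have "card ({} :: nat set set) \<in> X"
      unfolding X_def by blast
    then have "X \<noteq> {}" by blast
    with \<open>finite X\<close> have "Max X \<in> X" by (rule Max_in)
    then obtain E where "Max X = card E" "simple_graph {0..<n} E" "\<not> contains_Kss {0..<n} E s"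
      "\<not> contains_induced (cycle_V (2*k)) (cycle_E (2*k)) {0..<n} E"
      by (auto simp: X_def)
    then show ?thesis using C[of "{0..<n}" E] by (simp add: ex_star_def X_def)
  qed
  then show ?thesis by blast
qed

end
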